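(* Let $k>2$ be an integer, let $n=p_1p_2\cdots p_k$ where $p_1,\dots,p_k$ are distinct odd primes, and let $\zeta$ be a primitive $n$-th root of unity in $\bar{\mathbb{Q}}$. Let $c$ be a positive rational number such that $f=x^n-c$ is irreducible over $\mathbb{Q}$, let $a=c^{1/n}$ be the positive real root of $f$, and let $\mathbb{Q}_f=\mathbb{Q}(a,\zeta)$ be the splitting field of $f$. Consider the minimal generating set $B_2=\{a\zeta^{n/p_i}\}_{i=1}^k$ for $f$ over $\mathbb{Q}$ and the length $k$ cluster tower $$\mathbb{Q}\subseteq L_1\subseteq L_2\subseteq\dots\subseteq L_k=\mathbb{Q}_f,\qquad L_i=\mathbb{Q}(a\zeta^{n/p_1},a\zeta^{n/p_2},\dots,a\zeta^{n/p_i})\quad(1\le i\le k).$$ Then: (1) $L_i=\mathbb{Q}(a,\zeta^{n/(p_1p_2\cdots p_i)})$ for all $i\geq 2$. (2) The degree sequence of the cluster tower is $$(n,\ n\phi(p_1p_2),\ n\phi(p_1p_2p_3),\ \dots,\ n\phi(p_1p_2\cdots p_{k-1}),\ n\phi(n)).$$ (3) Let $\rho_{\mathbb{Q}}(L_i,a)$ be the number of roots of the minimal polynomial of $a$ over $\mathbb{Q}$ that are contained in $L_i$. Then $\rho_{\mathbb{Q}}(L_i,a)=p_1p_2\cdots p_i$ for $i\geq 2$, and $\rho_{\mathbb{Q}}(L_1,a)=1$.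
   Context: $\phi$ is Euler's totient function. A set $B$ of roots of $f$ is a minimal generating set for $f$ over $\mathbb{Q}$ if $\mathbb{Q}(B)=\mathbb{Q}_f$ and $\mathbb{Q}(A)\neq\mathbb{Q}_f$ for every $A\subsetneq B$. For an ordering $(\beta_1,\dots,\beta_m)$ of a minimal generating set, the chain $\mathbb{Q}\subseteq\mathbb{Q}(\beta_1)\subseteq\mathbb{Q}(\beta_1,\beta_2)\subseteq\dots\subseteq\mathbb{Q}(\beta_1,\dots,\beta_m)=\mathbb{Q}_f$ is a cluster tower associated with it; its length is the number of strict inclusions, and its degree sequence is the ordered sequence of degrees over $\mathbb{Q}$ of the distinct fields in the tower other than $\mathbb{Q}$. *)

theory Defs
  imports
    "HOL-Algebra.Generated_Fields"
    "HOL-Algebra.Algebraic_Closure_Type"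
    "HOL-Number_Theory.Totient"
    Complex_Main
begin

text \<open>
  All fields are subfields of the complex numbers. Every subfield contains \<open>\<rat>\<close>, so the subfield
  generated by \<open>S\<close> is \<open>\<rat>(S)\<close>.
\<close>

abbreviation complex_ring :: "complex ring" where
  "complex_ring \<equiv> ring_of_type_algebra"

definition adjoin_rat :: "complex set \<Rightarrow> complex set" where
  "adjoin_rat S = generate_field complex_ring S"

definition degree_rat :: "complex set \<Rightarrow> nat" where
  "degree_rat L = ring.dim complex_ring \<rat> L"

definition complex_roots :: "rat poly \<Rightarrow> complex set" where
  "complex_roots f = {z. poly (map_poly of_rat f) z = 0}"

definition splitting_field_rat :: "rat poly \<Rightarrow> complex set" where
  "splitting_field_rat f = adjoin_rat (complex_roots f)"

definition min_poly_rat :: "complex \<Rightarrow> rat poly" where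
  "min_poly_rat x =
     (THE p. Polynomial.lead_coeff p = 1 \<and> Factorial_Ring.irreducible p \<and> x \<in> complex_roots p)"

definition primitive_root_of_unity :: "nat \<Rightarrow> complex \<Rightarrow> bool" where
  "primitive_root_of_unity n z \<longleftrightarrow> n > 0 \<and> z ^ n = 1 \<and> (\<forall>m\<in>{0<..<n}. z ^ m \<noteq> 1)"

definition minimal_generating_set :: "rat poly \<Rightarrow> complex set \<Rightarrow> bool" where
  "minimal_generating_set f B \<longleftrightarrow>
     B \<subseteq> complex_roots f \<and> adjoin_rat B = splitting_field_rat f \<and>
     (\<forall>A. A \<subset> B \<longrightarrow> adjoin_rat A \<noteq> splitting_field_rat f)"

text \<open>
  A tower is the list of its fields in ascending order, beginning with \<open>\<rat>\<close>;
  repetitions are allowed.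
\<close>

definition cluster_tower :: "complex list \<Rightarrow> complex set list" where
  "cluster_tower bs = map (\<lambda>i. adjoin_rat (set (take i bs))) [0..<Suc (length bs)]"

definition tower_length :: "complex set list \<Rightarrow> nat" where
  "tower_length Fs = card {i. Suc i < length Fs \<and> Fs ! i \<subset> Fs ! Suc i}"

text \<open>
  Equal fields of an ascending tower are adjacent, so \<open>remdups\<close> leaves the order of the
  distinct fields unchanged.
\<close>

definition degree_sequence :: "complex set list \<Rightarrow> nat list" where
  "degree_sequence Fs = map degree_rat (filter (\<lambda>F. F \<noteq> \<rat>) (remdups Fs))"

definition root_count_rat :: "complex set \<Rightarrow> complex \<Rightarrow> nat" where
  "root_count_rat L x = card (complex_roots (min_poly_rat x) \<inter> L)"

end

theory Submission
  imports Defs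
begin

text \<open>
  Everything reduces to the degree formula \<open>[\<rat>(b, \<zeta>\<^sub>M) : \<rat>] = n \<phi>(M)\<close> for every divisor \<open>M\<close> of \<open>n\<close> and
  every root \<open>b\<close> of \<open>x^n - c\<close>. It shows that \<open>\<rat>(b, \<zeta>\<^sub>M)\<close> contains no \<open>n\<close>-th roots of unity besides
  the powers of \<open>\<zeta>\<^sub>M\<close>, since adjoining a further one would multiply the degree by some \<open>\<phi>(t) > 1\<close>;
  this gives the root counts, the strictness of the tower and the minimality of the generating set.

  The formula combines two facts. First, conjugates \<open>\<zeta>^j\<close> with \<open>j\<close> coprime to \<open>n\<close> satisfy the same
  rational equations as \<open>\<zeta>\<close>: for a monic integral divisor \<open>F\<close> of \<open>x^n - 1\<close> the remainder of \<open>F(x^q)\<close>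
  modulo \<open>F\<close> depends only on \<open>q\<close> mod \<open>n\<close>, and it is divisible by \<open>q\<close> when \<open>q\<close> is prime, hence
  vanishes for all large primes \<open>q\<close>; every \<open>j\<close> is congruent to a product of large primes.
  Second, \<open>x^n - c\<close> stays irreducible over \<open>\<rat>(\<zeta>)\<close>: up to sign and a root of unity, the constant
  term of a factor of degree \<open>d\<close> is \<open>a^d\<close>, and a real element \<open>r\<close> of \<open>\<rat>(\<zeta>)\<close> with \<open>r^n\<close> rational is
  itself rational, because all its conjugates are real \<open>n\<close>-th roots of the same number and \<open>n\<close> is odd.
\<close>

section \<open>Monic integral divisors of x^n - 1\<close>

text \<open>Only the inner terms of the binomial expansion remain, and a prime divides their
  coefficients. The ring is arbitrary because the congruence is applied both to integers and to
  integer polynomials.\<close>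

lemma prime_dvd_power_add_diff:
  fixes x y :: "'a::comm_ring_1"
  assumes "Factorial_Ring.prime q"
  shows "of_nat q dvd (x + y) ^ q - x ^ q - y ^ q"
proof -
  obtain r where q: "q = Suc r" using assms by (metis not0_implies_Suc not_prime_0)
  have r: "r > 0" using assms q by (cases r) auto
  have "(x + y) ^ q = (\<Sum>k\<le>q. of_nat (q choose k) * x ^ k * y ^ (q - k))"
    by (rule binomial_ring)
  also have "{..q} = insert 0 (insert q {1..r})" using q by auto
  also have "(\<Sum>k\<in>\<dots>. of_nat (q choose k) * x ^ k * y ^ (q - k))
     = y ^ q + (x ^ q + (\<Sum>k\<in>{1..r}. of_nat (q choose k) * x ^ k * y ^ (q - k)))"
    using q by simp
  finally have "(x + y) ^ q - x ^ q - y ^ q = (\<Sum>k\<in>{1..r}. of_nat (q choose k) * x ^ k * y ^ (q - k))"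
    by simp
  moreover have "of_nat q dvd (\<Sum>k\<in>{1..r}. of_nat (q choose k) * x ^ k * y ^ (q - k))"
  proof (rule dvd_sum)
    fix k assume k: "k \<in> {1..r}"
    have "q dvd q choose k" using k q assms by (intro dvd_choose_prime) auto
    then show "of_nat q dvd of_nat (q choose k) * x ^ k * y ^ (q - k)"
      by (elim dvdE) (simp add: mult.assoc)
  qed
  ultimately show ?thesis by simp
qed

text \<open>Fermat's little theorem: induction with the previous congruence settles the natural
  numbers, and reduction modulo \<open>q\<close> carries the result over to negative
  integers.\<close>

lemma prime_dvd_power_diff_int:
  assumes "Factorial_Ring.prime q"
  shows "int q dvd a ^ q - a"
proof -
  have nat: "int q dvd int m ^ q - int m" for m
  proof (induction m)
    case 0 then show ?case using assms by (simp add: prime_gt_0_nat zero_power)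
  next
    case (Suc m)
    have "int q dvd (int m + 1) ^ q - int m ^ q - 1 ^ q"
      using prime_dvd_power_add_diff[OF assms, of "int m" 1] by simp
    from dvd_add[OF this Suc] show ?case by (simp add: algebra_simps)
  qed
  have "[a ^ q = (a mod int q) ^ q] (mod int q)" by (simp add: cong_def power_mod)
  moreover have "[a = a mod int q] (mod int q)" by (simp add: cong_def)
  moreover have "[(a mod int q) ^ q = a mod int q] (mod int q)"
    using nat[of "nat (a mod int q)"] assms by (simp add: cong_iff_dvd_diff prime_gt_0_nat)
  ultimately show ?thesis by (metis cong_iff_dvd_diff cong_trans cong_sym)
qed

text \<open>Frobenius modulo \<open>q\<close>: the \<open>q\<close>-th power is additive, and by
  Fermat it fixes integer constants, so the splitting of \<open>pCons a p\<close> as a constant plus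
  \<open>X * p\<close> gives the induction step.\<close>

lemma prime_dvd_pcompose_monom_diff:
  fixes f :: "int poly"
  assumes "Factorial_Ring.prime q"
  shows "of_nat q dvd pcompose f (Polynomial.monom 1 q) - f ^ q"
proof (induction f)
  case 0 then show ?case using assms by (simp add: prime_gt_0_nat zero_power)
next
  case (pCons a p)
  let ?X = "Polynomial.monom 1 1 :: int poly"
  have X: "?X ^ q = Polynomial.monom 1 q" by (simp add: monom_power)
  have p: "pCons a p = [:a:] + ?X * p" by (simp add: monom_Suc)
  have "of_nat q dvd ([:a:] + ?X * p) ^ q - [:a:] ^ q - (?X * p) ^ q"
    by (rule prime_dvd_power_add_diff[OF assms])
  moreover have "(of_nat q :: int poly) dvd [:a:] ^ q - [:a:]"
  proof -
    have "(of_nat q :: int poly) = [:int q:]" by (simp add: of_nat_poly)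
    moreover have "[:a:] ^ q - [:a:] = [:a ^ q - a:]" by (simp add: poly_const_pow)
    ultimately show ?thesis using prime_dvd_power_diff_int[OF assms, of a]
      by (auto simp: const_poly_dvd_const_poly_iff)
  qed
  moreover have "of_nat q dvd Polynomial.monom 1 q * (pcompose p (Polynomial.monom 1 q) - p ^ q)"
    using pCons by simp
  ultimately have "of_nat q dvd Polynomial.monom 1 q * (pcompose p (Polynomial.monom 1 q) - p ^ q)
     - (([:a:] + ?X * p) ^ q - [:a:] ^ q - (?X * p) ^ q) - ([:a:] ^ q - [:a:])"
    by (simp only: dvd_diff)
  moreover have "\<dots> = pcompose (pCons a p) (Polynomial.monom 1 q) - (pCons a p) ^ q"
    unfolding p[symmetric] pcompose_pCons power_mult_distrib X by (simp add: algebra_simps)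
  ultimately show ?case by simp
qed

section \<open>Reduction modulo monic integral polynomials\<close>

lemma monic_remainder_exists:
  fixes f h :: "'a::idom poly"
  assumes "Polynomial.lead_coeff f = 1"
  obtains r where "f dvd h - r" "r = 0 \<or> Polynomial.degree r < Polynomial.degree f"
proof -
  obtain u r where ur: "pseudo_divmod h f = (u, r)" by fastforce
  have f0: "f \<noteq> 0" using assms by auto
  \<comment> \<open>Pseudo-division scales \<open>h\<close> by a power of the leading coefficient of
    \<open>f\<close>. That power is 1 here, so this is true division even over the integers.\<close>
  from pseudo_divmod[OF f0 ur] assms have "h = f * u + r" "r = 0 \<or> Polynomial.degree r < Polynomial.degree f"
    by simp_all
  then show ?thesis using that[of r] by simp
qed

text \<open>The alternatives \<open>r = 0\<close> and \<open>s = 0\<close> matter when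
  \<open>f\<close> is constant, since then no degree is below that of \<open>f\<close>.\<close>

lemma monic_remainder_unique:
  fixes f r s :: "'a::idom poly"
  assumes "f dvd r - s"
    and "r = 0 \<or> Polynomial.degree r < Polynomial.degree f"
    and "s = 0 \<or> Polynomial.degree s < Polynomial.degree f"
  shows "r = s"
proof (rule ccontr)
  assume "r \<noteq> s"
  then have "Polynomial.degree f \<le> Polynomial.degree (r - s)"
    using assms(1) by (intro dvd_imp_degree_le) auto
  moreover have "Polynomial.degree (r - s) < Polynomial.degree f"
    using assms(2,3) \<open>r \<noteq> s\<close> by (auto intro: degree_diff_less)
  ultimately show False by simp
qed

text \<open>Taken for two monomials with congruent exponents, this makes \<open>f(x^i)\<close>
  modulo a divisor of \<open>x^n - 1\<close> depend only on \<open>i\<close> modulo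
  \<open>n\<close>.\<close>

lemma dvd_pcompose_diff:
  fixes f g h :: "'a::comm_ring_1 poly"
  shows "g - h dvd pcompose f g - pcompose f h"
proof (induction f)
  case (pCons a p)
  have "pcompose (pCons a p) g - pcompose (pCons a p) h = g * (pcompose p g - pcompose p h) + (g - h) * pcompose p h"
    by (simp add: pcompose_pCons algebra_simps)
  then show ?case using pCons by simp
qed simp

lemma monom_minus_one_dvd:
  fixes n :: nat
  shows "(Polynomial.monom 1 n - 1 :: 'a::comm_ring_1 poly) dvd Polynomial.monom 1 (n * u) - 1"
proof -
  have "Polynomial.monom 1 (n * u) - 1 = (Polynomial.monom 1 n :: 'a poly) ^ u - 1"
    by (simp add: monom_power)
  also have "(Polynomial.monom 1 n - 1) dvd \<dots>"
    by (simp add: power_diff_1_eq)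
  finally show ?thesis .
qed

lemma monom_diff_dvd_cong:
  fixes n i j :: nat
  assumes "[i = j] (mod n)"
  shows "(Polynomial.monom 1 n - 1 :: 'a::comm_ring_1 poly) dvd Polynomial.monom 1 i - Polynomial.monom 1 j"
proof -
  have *: "(Polynomial.monom 1 n - 1 :: 'a poly) dvd Polynomial.monom 1 i - Polynomial.monom 1 (i mod n)" for i
  proof -
    have "(Polynomial.monom 1 i :: 'a poly) = Polynomial.monom 1 (i mod n) * Polynomial.monom 1 (n * (i div n))"
      by (simp add: mult_monom)
    then have "(Polynomial.monom 1 i - Polynomial.monom 1 (i mod n) :: 'a poly)
        = Polynomial.monom 1 (i mod n) * (Polynomial.monom 1 (n * (i div n)) - 1)"
      by (simp add: algebra_simps)
    then show ?thesis by (simp add: monom_minus_one_dvd)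
  qed
  have "(Polynomial.monom 1 i - Polynomial.monom 1 j :: 'a poly)
     = (Polynomial.monom 1 i - Polynomial.monom 1 (i mod n)) - (Polynomial.monom 1 j - Polynomial.monom 1 (j mod n))"
    using assms by (simp add: cong_def)
  then show ?thesis using dvd_diff[OF *[of i] *[of j]] by simp
qed

lemma dvd_pcompose_large_prime:
  fixes f :: "int poly"
  assumes f: "Polynomial.lead_coeff f = 1" and dvd: "f dvd Polynomial.monom 1 n - 1" and n: "n > 0"
  shows "\<exists>A. \<forall>q. Factorial_Ring.prime q \<longrightarrow> q > A \<longrightarrow> f dvd pcompose f (Polynomial.monom 1 q)"
proof -
  let ?X = "\<lambda>k. Polynomial.monom 1 k :: int poly"
  have "\<exists>r. f dvd pcompose f (?X j) - r \<and> (r = 0 \<or> Polynomial.degree r < Polynomial.degree f)" for j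
    using monic_remainder_exists[OF f] by metis
  then obtain R where R: "\<And>j. f dvd pcompose f (?X j) - R j"
     "\<And>j. R j = 0 \<or> Polynomial.degree (R j) < Polynomial.degree f" by metis
  \<comment> \<open>Only the residues \<open>j < n\<close> occur, so one sum over the coefficients
    of all their remainders gives a bound that serves every prime.\<close>
  define A where "A = (\<Sum>j<n. \<Sum>i\<le>Polynomial.degree (R j). nat \<bar>Polynomial.coeff (R j) i\<bar>)"
  have A: "\<bar>Polynomial.coeff (R j) i\<bar> \<le> int A" if "j < n" for i j
  proof (cases "i \<le> Polynomial.degree (R j)")
    case True
    have "nat \<bar>Polynomial.coeff (R j) i\<bar> \<le> (\<Sum>i\<le>Polynomial.degree (R j). nat \<bar>Polynomial.coeff (R j) i\<bar>)"
      using True by (intro member_le_sum) auto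
    also have "\<dots> \<le> A" unfolding A_def using that
      by (intro member_le_sum[where f = "\<lambda>j. \<Sum>i\<le>Polynomial.degree (R j). nat \<bar>Polynomial.coeff (R j) i\<bar>"]) auto
    finally show ?thesis by simp
  qed (simp add: coeff_eq_0)
  have "f dvd pcompose f (?X q)" if q: "Factorial_Ring.prime q" "q > A" for q
  proof -
    define j where "j = q mod n"
    have "?X n - 1 dvd ?X q - ?X j"
      by (rule monom_diff_dvd_cong) (simp add: cong_def j_def)
    also have "\<dots> dvd pcompose f (?X q) - pcompose f (?X j)" by (rule dvd_pcompose_diff)
    finally have 1: "f dvd pcompose f (?X q) - pcompose f (?X j)" using dvd by (rule dvd_trans[rotated])
    obtain h where h: "pcompose f (?X q) - f ^ q = of_nat q * h"
      using prime_dvd_pcompose_monom_diff[OF q(1), of f] by (auto elim: dvdE)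
    obtain s where s: "f dvd h - s" "s = 0 \<or> Polynomial.degree s < Polynomial.degree f"
      using monic_remainder_exists[OF f] by metis
    \<comment> \<open>Since \<open>f\<close> divides \<open>f ^ q\<close>, the remainder of
      \<open>f(x^q)\<close> is that of \<open>q h\<close>, namely \<open>q s\<close>. Uniqueness
      then identifies \<open>q s\<close> with \<open>R j\<close>.\<close>
    have "f dvd f ^ q" "f dvd of_nat q * (h - s)" using s(1) q by (auto simp: prime_gt_0_nat dvd_power)
    with 1 R(1)[of j]
    have "f dvd f ^ q + of_nat q * (h - s) - (pcompose f (?X q) - pcompose f (?X j)) - (pcompose f (?X j) - R j)"
      by (simp only: dvd_diff dvd_add)
    also have "\<dots> = R j - of_nat q * s" using h by (simp add: algebra_simps)
    finally have "f dvd R j - of_nat q * s" .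
    moreover have "of_nat q * s = 0 \<or> Polynomial.degree (of_nat q * s) < Polynomial.degree f"
      using s(2) q by (auto simp: of_nat_poly)
    ultimately have Rj: "R j = of_nat q * s" using R(2) by (intro monic_remainder_unique) auto
    have "R j = 0"
    proof (rule poly_eqI)
      fix i
      have "Polynomial.coeff (R j) i = int q * Polynomial.coeff s i" using Rj by (simp add: of_nat_poly)
      then have "int q dvd Polynomial.coeff (R j) i" by simp
      \<comment> \<open>A multiple of \<open>q\<close> whose absolute value is at most
        \<open>A < q\<close> must vanish.\<close>
      moreover have "\<bar>Polynomial.coeff (R j) i\<bar> < int q" using A[of j i] q n by (simp add: j_def)
      ultimately show "Polynomial.coeff (R j) i = Polynomial.coeff 0 i"
        using zdvd_not_zless[of "\<bar>Polynomial.coeff (R j) i\<bar>" "int q"] by auto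
    qed
    then have "f dvd pcompose f (?X j)" using R(1)[of j] by simp
    from dvd_add[OF 1 this] show ?thesis by simp
  qed
  then show ?thesis by blast
qed

lemma dvd_pcompose_prime_factors:
  fixes f :: "int poly"
  assumes "\<And>q. Factorial_Ring.prime q \<Longrightarrow> q > A \<Longrightarrow> f dvd pcompose f (Polynomial.monom 1 q)"
  shows "m > 0 \<Longrightarrow> (\<And>q. Factorial_Ring.prime q \<Longrightarrow> q dvd m \<Longrightarrow> q > A) \<Longrightarrow>
     f dvd pcompose f (Polynomial.monom 1 m)"
proof (induction m rule: less_induct)
  case (less m)
  show ?case
  proof (cases "m = 1")
    case True
    then show ?thesis by (simp add: monom_Suc one_pCons)
  next
    case False
    then obtain q where q: "Factorial_Ring.prime q" "q dvd m" using prime_factor_nat by blast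
    then obtain m' where m: "m = q * m'" by blast
    have m': "0 < m'" "m' < m" using m less.prems(1) prime_gt_1_nat[OF q(1)] by auto
    have "f dvd pcompose f (Polynomial.monom 1 m')"
      using less.IH[OF m'(2,1)] less.prems(2) m by simp
    \<comment> \<open>Substituting \<open>x^m'\<close> into the divisibility of
      \<open>f(x^q)\<close> by \<open>f\<close> preserves it.\<close>
    also have "\<dots> dvd pcompose (pcompose f (Polynomial.monom 1 q)) (Polynomial.monom 1 m')"
    proof -
      obtain u where "pcompose f (Polynomial.monom 1 q) = f * u"
        using assms q less.prems(2) by blast
      then show ?thesis by (simp add: pcompose_mult)
    qed
    also have "\<dots> = pcompose f (Polynomial.monom 1 m)"
    proof -
      have "pcompose (Polynomial.monom 1 q) (Polynomial.monom 1 m') = (Polynomial.monom 1 m :: int poly)"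
        by (simp add: m pcompose_altdef map_poly_monom poly_monom monom_power mult.commute flip: one_pCons)
      then show ?thesis by (simp flip: pcompose_assoc)
    qed
    finally show ?thesis .
  qed
qed

text \<open>An elementary stand-in for Dirichlet's theorem: the class of \<open>j\<close> need not
  be represented by a prime, only by a number all of whose prime factors are large.\<close>

lemma cong_avoiding_small_primes:
  fixes j n A :: nat
  assumes "coprime j n" "n > 0"
  obtains m where "m > 0" "[m = j] (mod n)" "\<And>q. Factorial_Ring.prime q \<Longrightarrow> q dvd m \<Longrightarrow> q > A"
proof -
  define S where "S = {q. Factorial_Ring.prime q \<and> q \<le> A \<and> \<not> q dvd j}"
  \<comment> \<open>A prime up to \<open>A\<close> divides exactly one of the two summands. If it
    divides \<open>j\<close>, it divides neither \<open>n\<close>, by coprimality, nor a prime in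
    \<open>S\<close>; otherwise it belongs to \<open>S\<close>.\<close>
  define m where "m = j + n * \<Prod>S"
  have fin: "finite S" by (rule finite_subset[of _ "{..A}"]) (auto simp: S_def)
  have "\<Prod>S > 0" by (rule prod_pos) (auto simp: S_def prime_gt_0_nat)
  show ?thesis
  proof
    show "m > 0" using \<open>\<Prod>S > 0\<close> assms by (simp add: m_def)
    show "[m = j] (mod n)" by (simp add: m_def cong_def)
    fix q :: nat assume q: "Factorial_Ring.prime q" "q dvd m"
    show "q > A"
    proof (rule ccontr)
      assume "\<not> q > A"
      show False
      proof (cases "q dvd j")
        case True
        then have "q dvd n * \<Prod>S" using q by (simp add: m_def dvd_add_right_iff)
        moreover have "\<not> q dvd n" using True assms q by (meson coprime_common_divisor not_prime_unit)
        ultimately have "q dvd \<Prod>S" using q by (simp add: prime_dvd_mult_iff)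
        then obtain s where "s \<in> S" "q dvd s" using fin q by (auto simp: prime_dvd_prod_iff)
        then have "q = s" using q by (auto simp: S_def intro: primes_dvd_imp_eq)
        then show False using \<open>s \<in> S\<close> True by (simp add: S_def)
      next
        case False
        then have "q \<in> S" using q \<open>\<not> q > A\<close> by (simp add: S_def)
        then have "q dvd \<Prod>S" using fin by (rule dvd_prodI[rotated])
        then have "q dvd j" using q by (simp add: m_def dvd_add_left_iff)
        then show False using False by simp
      qed
    qed
  qed
qed

lemma dvd_pcompose_coprime:
  fixes f :: "int poly"
  assumes f: "Polynomial.lead_coeff f = 1" and dvd: "f dvd Polynomial.monom 1 n - 1"
    and n: "n > 0" and j: "coprime j n"
  shows "f dvd pcompose f (Polynomial.monom 1 j)"
proof -
  obtain A where A: "\<And>q. Factorial_Ring.prime q \<Longrightarrow> q > A \<Longrightarrow> f dvd pcompose f (Polynomial.monom 1 q)"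
    using dvd_pcompose_large_prime[OF f dvd n] by blast
  obtain m where m: "m > 0" "[m = j] (mod n)" "\<And>q. Factorial_Ring.prime q \<Longrightarrow> q dvd m \<Longrightarrow> q > A"
    using cong_avoiding_small_primes[OF j n] by metis
  have 1: "f dvd pcompose f (Polynomial.monom 1 m)"
    by (rule dvd_pcompose_prime_factors[OF A m(1,3)])
  have "f dvd pcompose f (Polynomial.monom 1 m) - pcompose f (Polynomial.monom 1 j)"
    using dvd monom_diff_dvd_cong[OF m(2)] dvd_pcompose_diff by (meson dvd_trans)
  from dvd_diff[OF 1 this] show ?thesis by simp
qed

section \<open>Conjugates of roots of unity\<close>

abbreviation complex_poly :: "rat poly \<Rightarrow> complex poly" where
  "complex_poly \<equiv> map_poly of_rat"

lemma map_poly_of_rat_add: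
  "map_poly (of_rat :: rat \<Rightarrow> 'a::field_char_0) (p + q) = map_poly of_rat p + map_poly of_rat q"
  by (rule poly_eqI) (simp add: coeff_map_poly of_rat_add)

lemma map_poly_of_rat_diff:
  "map_poly (of_rat :: rat \<Rightarrow> 'a::field_char_0) (p - q) = map_poly of_rat p - map_poly of_rat q"
  by (rule poly_eqI) (simp add: coeff_map_poly of_rat_diff)

lemma map_poly_of_rat_mult:
  "map_poly (of_rat :: rat \<Rightarrow> 'a::field_char_0) (p * q) = map_poly of_rat p * map_poly of_rat q"
  by (rule poly_eqI) (simp add: coeff_map_poly coeff_mult of_rat_sum of_rat_mult)

lemma map_poly_of_rat_power:
  "map_poly (of_rat :: rat \<Rightarrow> 'a::field_char_0) (p ^ k) = map_poly of_rat p ^ k"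
  by (induction k) (simp_all add: map_poly_of_rat_mult)

lemma degree_complex_poly [simp]: "Polynomial.degree (complex_poly p) = Polynomial.degree p"
  by (rule degree_map_poly) simp

lemma complex_poly_eq_0_iff [simp]: "complex_poly p = 0 \<longleftrightarrow> p = 0"
  by (rule map_poly_eq_0_iff) auto

lemma degree_monom_minus_const:
  "n > 0 \<Longrightarrow> Polynomial.degree (Polynomial.monom 1 n - [:c::'a::comm_ring_1:]) = n"
  unfolding diff_conv_add_uminus by (subst degree_add_eq_left) (simp_all add: degree_monom_eq)

lemma complex_poly_monom_minus_const:
  "complex_poly (Polynomial.monom 1 n - [:c:]) = Polynomial.monom 1 n - [:of_rat c:]"
  by (simp add: map_poly_of_rat_diff map_poly_monom map_poly_pCons)

lemma complex_poly_monom_minus_1: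
  "complex_poly (Polynomial.monom 1 n - 1) = Polynomial.monom 1 n - 1"
  by (simp add: map_poly_of_rat_diff map_poly_monom)

lemma poly_complex_poly_gcd:
  assumes "poly (complex_poly f) z = 0" "poly (complex_poly g) z = 0"
  shows "poly (complex_poly (gcd f g)) z = 0"
proof -
  obtain u v where "gcd f g = u * f + v * g"
    by (metis bezout_coefficients_fst_snd)
  then show ?thesis using assms by (simp add: map_poly_of_rat_add map_poly_of_rat_mult)
qed

section \<open>Gauss's lemma for monic rational factors\<close>

lemma map_poly_of_int_mult:
  "map_poly (of_int :: int \<Rightarrow> 'a::{idom,ring_char_0}) (p * q) = map_poly of_int p * map_poly of_int q"
  by (rule poly_eqI) (simp add: coeff_map_poly coeff_mult)

lemma map_poly_of_int_diff:
  "map_poly (of_int :: int \<Rightarrow> 'a::{idom,ring_char_0}) (p - q) = map_poly of_int p - map_poly of_int q"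
  by (rule poly_eqI) (simp add: coeff_map_poly)

lemma map_poly_of_int_smult:
  "map_poly (of_int :: int \<Rightarrow> 'a::{idom,ring_char_0}) (Polynomial.smult a p) = Polynomial.smult (of_int a) (map_poly of_int p)"
  by (rule poly_eqI) (simp add: coeff_map_poly)

lemma map_poly_of_int_eq_iff:
  "map_poly (of_int :: int \<Rightarrow> 'a::{idom,ring_char_0}) p = map_poly of_int q \<longleftrightarrow> p = q"
  by (auto simp: poly_eq_iff coeff_map_poly)

lemma rat_poly_eq_smult_primitive:
  fixes p :: "rat poly"
  assumes "p \<noteq> 0"
  obtains c F where "content F = 1" "p = Polynomial.smult c (map_poly of_int F)"
proof -
  have "\<exists>d::int. d \<noteq> 0 \<and> (\<exists>F. Polynomial.smult (of_int d) p = map_poly of_int F)"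
  proof (induction p)
    case 0 show ?case by (rule exI[of _ 1]) (auto intro: exI[of _ 0])
  next
    case (pCons a p)
    then obtain d F where dF: "d \<noteq> 0" "Polynomial.smult (of_int d) p = map_poly of_int F" by blast
    obtain x y where xy: "quotient_of a = (x, y)" by fastforce
    have a: "a = of_int x / of_int y" and y: "y > 0"
      using quotient_of_div[OF xy] quotient_of_denom_pos[OF xy] by auto
    have "Polynomial.smult (of_int (d * y)) (pCons a p) = map_poly of_int (pCons (d * x) (Polynomial.smult y F))"
      using dF(2) a y by (simp add: map_poly_pCons map_poly_of_int_smult mult.commute flip: dF(2))
    then show ?case using dF(1) y by (metis less_irrefl mult_eq_0_iff)
  qed
  then obtain d F where dF: "d \<noteq> 0" "Polynomial.smult (of_int d) p = map_poly of_int F" by blast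
  have "F \<noteq> 0" using dF assms by auto
  have "p = Polynomial.smult (inverse (of_int d)) (map_poly of_int F)"
    using dF by (simp flip: dF(2))
  also have "F = Polynomial.smult (content F) (primitive_part F)" by simp
  also have "Polynomial.smult (inverse (of_int d)) (map_poly of_int \<dots>) =
     Polynomial.smult (inverse (of_int d) * of_int (content F)) (map_poly of_int (primitive_part F) :: rat poly)"
    by (simp only: map_poly_of_int_smult smult_smult)
  finally show ?thesis using that[of "primitive_part F"] \<open>F \<noteq> 0\<close> by simp
qed

text \<open>Both factors are multiples of primitive integer polynomials. As \<open>G\<close> is
  primitive too, comparing contents forces the combined scalar to be a sign.\<close>

lemma monic_rat_factor_is_int:
  fixes f :: "rat poly" and G :: "int poly"
  assumes f: "Polynomial.lead_coeff f = 1" and dvd: "f dvd map_poly of_int G"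
    and G: "Polynomial.lead_coeff G = 1"
  obtains F where "Polynomial.lead_coeff F = 1" "F dvd G" "f = map_poly of_int F"
proof -
  obtain h where h: "map_poly of_int G = f * h" using dvd by blast
  have G0: "G \<noteq> 0" using G by auto
  then have h0: "f \<noteq> 0" "h \<noteq> 0" using h f map_poly_of_int_eq_iff[of G 0, where 'a = rat] by auto
  obtain c F where F: "content F = 1" "f = Polynomial.smult c (map_poly of_int F)"
    using rat_poly_eq_smult_primitive[OF h0(1)] .
  obtain d H where H: "content H = 1" "h = Polynomial.smult d (map_poly of_int H)"
    using rat_poly_eq_smult_primitive[OF h0(2)] .
  \<comment> \<open>Clearing the denominator of \<open>c * d\<close> turns the factorization into an
    identity of integer polynomials, to which \<open>content\<close> applies.\<close>
  obtain u v where uv: "quotient_of (c * d) = (u, v)" by fastforce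
  have cd: "c * d = of_int u / of_int v" and v: "v > 0"
    using quotient_of_div[OF uv] quotient_of_denom_pos[OF uv] by auto
  have "map_poly of_int (Polynomial.smult v G) = (map_poly of_int (Polynomial.smult u (F * H)) :: rat poly)"
    using cd v by (simp add: h F(2) H(2) map_poly_of_int_smult map_poly_of_int_mult field_simps)
  then have eq: "Polynomial.smult v G = Polynomial.smult u (F * H)"
    by (simp only: map_poly_of_int_eq_iff)
  have "content G dvd 1" using content_dvd_coeff[of G "Polynomial.degree G"] G by simp
  then have "content G = 1" by (simp only: is_unit_content_iff)
  with F(1) H(1) have "\<bar>v\<bar> = \<bar>u\<bar>"
    using arg_cong[OF eq, of content] by (simp add: content_mult)
  then have "u = v \<or> u = - v" by linarith
  then obtain s where s: "u = s * v" by (metis mult_1 mult_minus1)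
  have "Polynomial.smult v G = Polynomial.smult v (Polynomial.smult s (F * H))"
    unfolding eq s by (simp add: mult.commute)
  moreover have "v \<noteq> 0" using v by simp
  ultimately have GFH: "G = Polynomial.smult s (F * H)" by (rule smult_cancel[rotated])
  \<comment> \<open>This leading coefficient divides that of \<open>G\<close>, which is 1, so it is
    1 or -1. Since \<open>f\<close> is monic, \<open>c\<close> equals \<open>t\<close>, and
    \<open>t F\<close> is the integral form of \<open>f\<close>.\<close>
  define t where "t = Polynomial.lead_coeff F"
  have "t * (Polynomial.lead_coeff H * s) = 1"
    using G unfolding GFH lead_coeff_smult lead_coeff_mult t_def by (simp only: mult_ac)
  then have "t dvd 1" by (rule dvdI[OF sym])
  then have "t = 1 \<or> t = - 1" by auto
  then have t: "t * t = 1" by auto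
  have "c * of_int t = 1" using f unfolding F(2) lead_coeff_smult
    by (simp add: t_def coeff_map_poly degree_map_poly)
  then have "c * of_int t * of_int t = of_int t" by simp
  then have "c * of_int (t * t) = of_int t" by (simp only: of_int_mult mult.assoc)
  then have "c = of_int t" unfolding t by simp
  show ?thesis
  proof (rule that[of "Polynomial.smult t F"])
    show "Polynomial.lead_coeff (Polynomial.smult t F) = 1" using t by (auto simp: t_def)
    show "Polynomial.smult t F dvd G" using GFH \<open>t = 1 \<or> t = - 1\<close> by (auto intro: dvd_smult)
    show "f = map_poly of_int (Polynomial.smult t F)" using F(2) \<open>c = of_int t\<close> by (simp add: map_poly_of_int_smult)
  qed
qed

lemma poly_map_of_int_pcompose_monom:
  "poly (map_poly of_int (pcompose F (Polynomial.monom 1 j))) z = poly (map_poly of_int F) ((z::'a::{idom,ring_char_0}) ^ j)"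
proof (induction F)
  case (pCons a F)
  have "map_poly of_int (pcompose (pCons a F) (Polynomial.monom 1 j))
     = [:of_int a:] + Polynomial.monom 1 j * (map_poly of_int (pcompose F (Polynomial.monom 1 j)) :: 'a poly)"
    by (rule poly_eqI) (simp add: coeff_map_poly pcompose_pCons coeff_pCons coeff_monom_mult split: nat.split)
  then show ?case using pCons by (simp add: map_poly_pCons poly_monom)
qed simp

text \<open>The gcd of \<open>g\<close> and \<open>x^n - 1\<close> is monic and divides
  \<open>x^n - 1\<close>, hence is integral by Gauss's lemma. The divisibility of
  \<open>F(x^j)\<close> by \<open>F\<close>, evaluated at \<open>z\<close>, makes
  \<open>z ^ j\<close> a root of the gcd and so of \<open>g\<close>.\<close>

theorem root_of_unity_conjugate:
  fixes g :: "rat poly" and z :: complex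
  assumes z: "z ^ n = 1" and n: "n > 0" and g: "poly (complex_poly g) z = 0" and j: "coprime j n"
  shows "poly (complex_poly g) (z ^ j) = 0"
proof -
  define Q where "Q = (Polynomial.monom 1 n - 1 :: rat poly)"
  define f where "f = gcd g Q"
  have Q0: "Q \<noteq> 0" using n by (auto simp: Q_def monom_eq_1_iff)
  then have "f \<noteq> 0" by (simp add: f_def)
  then have f: "Polynomial.lead_coeff f = 1"
    using unit_factor_gcd[of g Q] Q0 unfolding f_def unit_factor_poly_def by (auto simp: one_pCons)
  have QG: "Q = map_poly of_int (Polynomial.monom 1 n - 1)"
    by (simp add: Q_def map_poly_of_int_diff map_poly_monom)
  have deg: "Polynomial.degree (Polynomial.monom 1 n - 1 :: int poly) = n"
    using n degree_monom_minus_const[of n "1 :: int"] by (simp add: one_pCons)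
  have lc: "Polynomial.lead_coeff (Polynomial.monom 1 n - 1 :: int poly) = 1"
    unfolding deg using n by simp
  have "f dvd map_poly of_int (Polynomial.monom 1 n - 1)" by (simp add: f_def flip: QG)
  from monic_rat_factor_is_int[OF f this lc] obtain F
    where F: "Polynomial.lead_coeff F = 1" "F dvd Polynomial.monom 1 n - 1" "f = map_poly of_int F" .
  have fF: "complex_poly f = map_poly of_int F"
    by (simp add: F(3) map_poly_map_poly o_def)
  have "poly (complex_poly Q) z = 0"
    using z by (simp add: Q_def complex_poly_monom_minus_1 poly_monom)
  then have "poly (complex_poly f) z = 0" unfolding f_def using g by (rule poly_complex_poly_gcd[rotated])
  moreover obtain U where "pcompose F (Polynomial.monom 1 j) = F * U"
    using dvd_pcompose_coprime[OF F(1,2) n j] by blast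
  then have "poly (map_poly of_int F) (z ^ j) = poly (map_poly of_int F) z * poly (map_poly of_int U) z"
    by (simp flip: poly_map_of_int_pcompose_monom add: map_poly_of_int_mult)
  ultimately have "poly (complex_poly f) (z ^ j) = 0" by (simp add: fF)
  moreover have "f dvd g" by (simp add: f_def)
  ultimately show ?thesis by (auto elim!: dvdE simp: map_poly_of_rat_mult)
qed

section \<open>Primitive roots of unity and their degree over the rationals\<close>

lemma primitive_root_of_unity_power_eq_1_iff:
  assumes "primitive_root_of_unity n z"
  shows "z ^ i = 1 \<longleftrightarrow> n dvd i"
proof
  have n: "n > 0" "z ^ n = 1" "\<And>m. 0 < m \<Longrightarrow> m < n \<Longrightarrow> z ^ m \<noteq> 1"
    using assms by (auto simp: primitive_root_of_unity_def)
  assume "z ^ i = 1"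
  moreover have "z ^ i = (z ^ n) ^ (i div n) * z ^ (i mod n)"
    by (simp flip: power_mult power_add)
  ultimately have "z ^ (i mod n) = 1" using n by simp
  then show "n dvd i" using n by (metis bot_nat_0.not_eq_extremum mod_eq_0_iff_dvd mod_less_divisor)
next
  assume "n dvd i"
  then show "z ^ i = 1" using assms by (auto simp: primitive_root_of_unity_def power_mult)
qed

text \<open>Exponents run through \<open>{0<..n}\<close> because this is the range that contains
  \<open>totatives n\<close>, also for \<open>n = 1\<close>.\<close>

lemma primitive_root_of_unity_inj_on:
  assumes "primitive_root_of_unity n z"
  shows "inj_on (\<lambda>i. z ^ i) {0<..n}"
proof (rule linorder_inj_onI)
  fix i j assume ij: "i < j" "i \<in> {0<..n}" "j \<in> {0<..n}"
  have "n > 0" "z ^ n = 1" using assms by (simp_all add: primitive_root_of_unity_def)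
  then have "z \<noteq> 0" by (metis zero_neq_one zero_power)
  show "z ^ i \<noteq> z ^ j"
  proof
    assume "z ^ i = z ^ j"
    moreover have "z ^ j = z ^ i * z ^ (j - i)" using ij by (simp flip: power_add)
    ultimately have "z ^ (j - i) = 1" using \<open>z \<noteq> 0\<close> by simp
    then show False using ij assms
      by (auto simp: primitive_root_of_unity_power_eq_1_iff dest: dvd_imp_le)
  qed
qed auto

lemma roots_of_unity_eq_powers:
  assumes "primitive_root_of_unity n z"
  shows "{w. w ^ n = 1} = (\<lambda>i. z ^ i) ` {0<..n}"
proof (rule sym, rule card_subset_eq)
  have n: "n > 0" using assms by (auto simp: primitive_root_of_unity_def)
  show "finite {w::complex. w ^ n = 1}" 
    by (rule card_ge_0_finite) (simp add: card_roots_unity_eq n)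
  show "(\<lambda>i. z ^ i) ` {0<..n} \<subseteq> {w. w ^ n = 1}"
    using assms by (auto simp: primitive_root_of_unity_power_eq_1_iff simp flip: power_mult)
  show "card ((\<lambda>i. z ^ i) ` {0<..n}) = card {w::complex. w ^ n = 1}"
    using n assms by (simp add: card_roots_unity_eq card_image primitive_root_of_unity_inj_on)
qed

lemma card_primitive_powers:
  assumes "primitive_root_of_unity n z"
  shows "card ((\<lambda>i. z ^ i) ` totatives n) = totient n"
  using inj_on_subset[OF primitive_root_of_unity_inj_on[OF assms] totatives_subset]
  by (simp add: card_image totient_def)

text \<open>Stated for complex coefficients, since it is later applied to a polynomial with a
  constant term not yet known to be rational.\<close>

lemma totient_le_degree:
  assumes z: "primitive_root_of_unity n z" and "q \<noteq> 0" "\<forall>i\<in>totatives n. poly q (z ^ i) = 0"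
  shows "totient n \<le> Polynomial.degree q"
proof -
  have "totient n = card ((\<lambda>i. z ^ i) ` totatives n)" by (simp add: card_primitive_powers[OF z])
  also have "\<dots> \<le> card {x. poly q x = 0}"
    using assms by (intro card_mono poly_roots_finite) auto
  also have "\<dots> \<le> Polynomial.degree q" using assms(2) by (rule card_poly_roots_bound)
  finally show ?thesis .
qed

lemma totient_le_degree_rat:
  assumes z: "primitive_root_of_unity n z" and q: "q \<noteq> 0" "poly (complex_poly q) z = 0"
  shows "totient n \<le> Polynomial.degree q"
proof -
  have "poly (complex_poly q) (z ^ i) = 0" if "i \<in> totatives n" for i
    using z q that
    by (intro root_of_unity_conjugate[of _ n]) (auto simp: primitive_root_of_unity_def in_totatives_iff)
  then show ?thesis using totient_le_degree[OF z, of "complex_poly q"] q by auto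
qed

text \<open>A nonzero rational polynomial of least degree vanishing at \<open>z\<close> works. Its
  roots are simple and of the form \<open>z ^ i\<close> with \<open>i\<close> coprime to
  \<open>n\<close>, which bounds the degree above; the conjugates of \<open>z\<close> bound it
  below.\<close>

lemma rat_poly_degree_totient_exists:
  assumes z: "primitive_root_of_unity n z"
  obtains f where "f \<noteq> 0" "poly (complex_poly f) z = 0" "Polynomial.degree f = totient n"
proof -
  have n: "n > 0" "z ^ n = 1" using z by (auto simp: primitive_root_of_unity_def)
  let ?P = "\<lambda>f :: rat poly. f \<noteq> 0 \<and> poly (complex_poly f) z = 0"
  define Q where "Q k = (Polynomial.monom 1 k - 1 :: rat poly)" for k
  have Q_root: "poly (complex_poly (Q k)) w = w ^ k - 1" for k w
    by (simp add: Q_def complex_poly_monom_minus_1 poly_monom)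
  have Q0: "Q k \<noteq> 0" if "k > 0" for k using that by (auto simp: Q_def monom_eq_1_iff)
  have "?P (Q n)" using n Q0 by (simp add: Q_root)
  then obtain f where f: "?P f" and min: "\<And>g. ?P g \<Longrightarrow> Polynomial.degree f \<le> Polynomial.degree g"
    using ex_has_least_nat[of ?P "Q n" Polynomial.degree] by blast
  have dvd: "f dvd Q n"
  proof (rule ccontr)
    assume "\<not> f dvd Q n"
    then have "Q n mod f \<noteq> 0" "Polynomial.degree (Q n mod f) < Polynomial.degree f"
      using f by (auto simp: mod_eq_0_iff_dvd intro: degree_mod_less_degree)
    moreover have "poly (complex_poly (Q n mod f)) z = 0"
      using f n by (simp add: minus_mult_div_eq_mod[symmetric] map_poly_of_rat_diff map_poly_of_rat_mult Q_root)
    ultimately show False using min[of "Q n mod f"] by auto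
  qed
  then obtain u where u: "Q n = f * u" by blast
  have roots: "{w. poly (complex_poly f) w = 0} \<subseteq> (\<lambda>i. z ^ i) ` totatives n"
  proof
    fix w assume "w \<in> {w. poly (complex_poly f) w = 0}"
    then have w: "poly (complex_poly f) w = 0" by simp
    then have "poly (complex_poly (Q n)) w = 0" unfolding u by (simp add: map_poly_of_rat_mult)
    then have "w \<in> {w. w ^ n = 1}" by (simp add: Q_root)
    then obtain i where i: "i \<in> {0<..n}" "w = z ^ i"
      unfolding roots_of_unity_eq_powers[OF z] by blast
    have "coprime i n"
    proof (rule ccontr)
      assume "\<not> coprime i n"
      \<comment> \<open>With \<open>k = n / g\<close>, the root \<open>w\<close> satisfies
        \<open>w ^ k = 1\<close> while \<open>z ^ k\<close> differs from 1. So the gcd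
        \<open>e\<close> of \<open>f\<close> and \<open>x^k - 1\<close> is a nonconstant factor of
        \<open>f\<close> not vanishing at \<open>z\<close>, and its cofactor contradicts the
        minimality of \<open>f\<close>.\<close>
      define g where "g = gcd i n"
      have g: "g \<noteq> 1" "g > 0" using \<open>\<not> coprime i n\<close> n by (auto simp: g_def coprime_iff_gcd_eq_1)
      obtain k where k: "n = g * k" using g_def by (metis gcd_dvd2 dvdE)
      obtain l where l: "i = g * l" using g_def by (metis gcd_dvd1 dvdE)
      have k0: "k > 0" "k < n" using k n g by (auto intro: Nat.gr0I)
      have "w ^ k = (z ^ n) ^ l" unfolding i k l by (simp add: mult_ac flip: power_mult)
      then have wk: "w ^ k = 1" using n by simp
      define e where "e = gcd f (Q k)"
      have e_root: "poly (complex_poly e) w = 0" unfolding e_def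
        using w wk by (intro poly_complex_poly_gcd) (auto simp: Q_root)
      have e0: "e \<noteq> 0" using f by (simp add: e_def)
      have "Polynomial.degree e \<noteq> 0"
      proof
        assume "Polynomial.degree e = 0"
        then obtain c where "e = [:c:]" by (metis degree_eq_zeroE)
        then show False using e_root e0 by (simp add: map_poly_pCons)
      qed
      obtain v where v: "f = e * v" unfolding e_def by (metis gcd_dvd1 dvdE)
      obtain v' where v': "Q k = e * v'" unfolding e_def by (metis gcd_dvd2 dvdE)
      have "z ^ k \<noteq> 1" using z k0 by (auto simp: primitive_root_of_unity_def)
      then have "poly (complex_poly (e * v')) z \<noteq> 0" unfolding v'[symmetric] by (simp add: Q_root)
      then have "poly (complex_poly e) z \<noteq> 0" by (simp add: map_poly_of_rat_mult)
      moreover have "poly (complex_poly (e * v)) z = 0" using f v by simp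
      ultimately have "poly (complex_poly v) z = 0" by (simp add: map_poly_of_rat_mult)
      moreover have "v \<noteq> 0" using f v by auto
      ultimately have "Polynomial.degree f \<le> Polynomial.degree v" using min by auto
      moreover have "Polynomial.degree f = Polynomial.degree e + Polynomial.degree v"
        unfolding v using e0 \<open>v \<noteq> 0\<close> by (rule degree_mult_eq)
      ultimately show False using \<open>Polynomial.degree e \<noteq> 0\<close> by simp
    qed
    then show "w \<in> (\<lambda>i. z ^ i) ` totatives n" using i by (auto simp: in_totatives_iff)
  qed
  \<comment> \<open>A multiple root of \<open>f\<close> would be one of \<open>x^n - 1\<close>,
    whose derivative can vanish only at 0. Hence the degree of \<open>f\<close> is its number of
    distinct roots.\<close>
  have "rsquarefree (complex_poly f)"
    unfolding rsquarefree_roots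
  proof (intro allI notI)
    fix w assume w: "poly (complex_poly f) w = 0 \<and> poly (pderiv (complex_poly f)) w = 0"
    have "Polynomial.monom 1 n - 1 = complex_poly f * complex_poly u"
      using arg_cong[OF u, of complex_poly] by (simp add: Q_def complex_poly_monom_minus_1 map_poly_of_rat_mult)
    then have "poly (pderiv (Polynomial.monom 1 n - 1)) w = 0" "poly (Polynomial.monom 1 n - 1) w = 0"
      using w by (simp_all add: pderiv_mult)
    then have "w = 0" "w ^ n = 1" using n by (auto simp: pderiv_diff pderiv_monom poly_monom)
    then show False using n(1) by (metis zero_neq_one zero_power)
  qed
  from complex_poly_decompose_rsquarefree[OF this]
  have "Polynomial.degree (complex_poly f) =
     Polynomial.degree (Polynomial.smult (Polynomial.lead_coeff (complex_poly f)) (\<Prod>z|poly (complex_poly f) z = 0. [:-z, 1:]))"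
    by simp
  also have "\<dots> \<le> card {w. poly (complex_poly f) w = 0}"
    by (rule order.trans[OF degree_smult_le]) (simp add: degree_prod_sum_eq)
  also have "\<dots> \<le> card ((\<lambda>i. z ^ i) ` totatives n)" using roots by (intro card_mono) auto
  also have "\<dots> = totient n" by (rule card_primitive_powers[OF z])
  finally have "Polynomial.degree f \<le> totient n" by simp
  moreover have "totient n \<le> Polynomial.degree f" using f by (intro totient_le_degree_rat[OF z]) auto
  ultimately show ?thesis using that f by auto
qed

lemma real_power_odd_cancel:
  fixes x y :: real
  assumes "odd n" "x ^ n = y ^ n"
  shows "x = y"
proof -
  have "root n (x ^ n) = root n (y ^ n)" by (rule arg_cong[OF assms(2)])
  then show ?thesis unfolding odd_real_root_power_cancel[OF assms(1)] .
qed

text \<open>Both \<open>r ^ m = s\<close> and the reality of \<open>r\<close> are rational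
  polynomial equations in \<open>z\<close>, so they pass to the conjugates. Real \<open>m\<close>-th
  roots being unique for odd \<open>m\<close>, every conjugate of \<open>r\<close> equals
  \<open>r\<close>.\<close>

lemma real_radical_in_cyclotomic_field_is_rat:
  fixes q :: "rat poly"
  assumes z: "primitive_root_of_unity n z" and r: "r = poly (complex_poly q) z" "r \<in> \<real>"
    and m: "odd m" and s: "r ^ m \<in> \<rat>"
  shows "r \<in> \<rat>"
proof -
  have n: "n > 0" "z ^ n = 1" using z by (auto simp: primitive_root_of_unity_def)
  obtain s where s: "r ^ m = of_rat s" using s by (auto elim: Rats_cases)
  obtain f where f: "f \<noteq> 0" "poly (complex_poly f) z = 0" "Polynomial.degree f = totient n"
    using rat_poly_degree_totient_exists[OF z] .
  \<comment> \<open>Reducing modulo \<open>f\<close> brings the degree below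
    \<open>totient n\<close>, so that agreement at all conjugates of \<open>z\<close> determines the
    polynomial.\<close>
  define g where "g = q mod f"
  have "totient n > 0" using n by simp
  then have deg: "Polynomial.degree g < totient n"
    using degree_mod_less'[of f q] f by (cases "g = 0") (auto simp: g_def)
  have gz: "poly (complex_poly g) z = r"
    using f r by (simp add: g_def minus_mult_div_eq_mod[symmetric] map_poly_of_rat_diff map_poly_of_rat_mult)
  have cnj_g: "cnj (poly (complex_poly g) w) = poly (complex_poly g) (cnj w)" for w
  proof -
    have "map_poly cnj (complex_poly g) = complex_poly g"
    proof (rule poly_eqI)
      fix i
      have "cnj (of_rat x) = of_rat x" for x :: rat by (cases x) (simp add: of_rat_rat)
      then show "Polynomial.coeff (map_poly cnj (complex_poly g)) i = Polynomial.coeff (complex_poly g) i"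
        by (simp add: coeff_map_poly)
    qed
    then show ?thesis using poly_cnj[of "complex_poly g" w] by simp
  qed
  have cnj_root: "cnj w = w ^ (n - 1)" if "w ^ n = 1" for w :: complex
  proof -
    have "norm w ^ n = 1" using that by (metis norm_one norm_power)
    then have "norm w ^ n = 1 ^ n" by simp
    from power_eq_imp_eq_base[OF this norm_ge_zero] n(1) have "norm w = 1" by simp
    then have "w * cnj w = 1" by (simp add: complex_norm_square[symmetric])
    moreover have "w * w ^ (n - 1) = 1" using that n by (simp add: power_eq_if)
    moreover have "w \<noteq> 0" using \<open>norm w = 1\<close> by auto
    ultimately show ?thesis by (metis mult_left_cancel)
  qed
  have conj: "poly (complex_poly g) (z ^ j) = r" if j: "j \<in> totatives n" for j
  proof -
    have cop: "coprime j n" using j by (simp add: in_totatives_iff)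
    let ?w = "z ^ j"
    have wn: "?w ^ n = 1" using n by (metis power_commutes power_mult mult.commute power_one)
    have "poly (complex_poly (g ^ m - [:s:])) z = 0"
      by (simp add: map_poly_of_rat_diff map_poly_of_rat_power map_poly_pCons gz s)
    from root_of_unity_conjugate[OF n(2,1) this cop]
    have pow: "poly (complex_poly g) ?w ^ m = r ^ m"
      by (simp add: map_poly_of_rat_diff map_poly_of_rat_power map_poly_pCons s)
    \<comment> \<open>On \<open>n\<close>-th roots of unity, complex conjugation is the power map
      with exponent \<open>n - 1\<close>. So \<open>h\<close> vanishes at such a root exactly when
      the value of \<open>g\<close> there is real.\<close>
    define h where "h = g - pcompose g (Polynomial.monom 1 (n - 1))"
    have h: "poly (complex_poly h) w = poly (complex_poly g) w - poly (complex_poly g) (w ^ (n - 1))" for w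
    proof -
      have "complex_poly (pcompose g (Polynomial.monom 1 (n - 1))) = pcompose (complex_poly g) (Polynomial.monom 1 (n - 1))"
      proof (induction g)
        case (pCons c g)
        have "map_poly of_rat ([:c:] + Polynomial.monom 1 (n-1) * pcompose g (Polynomial.monom 1 (n - 1)))
          = [:of_rat c:] + Polynomial.monom 1 (n-1) * complex_poly (pcompose g (Polynomial.monom 1 (n - 1)))"
          by (simp add: map_poly_of_rat_add map_poly_of_rat_mult map_poly_monom map_poly_pCons)
        then show ?case using pCons by (simp add: pcompose_pCons map_poly_pCons)
      qed simp
      then show ?thesis by (simp add: h_def map_poly_of_rat_diff poly_pcompose poly_monom)
    qed
    have "poly (complex_poly h) z = 0"
      using r(2) cnj_g[of z] cnj_root[OF n(2)] gz by (simp add: h Reals_cnj_iff)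
    from root_of_unity_conjugate[OF n(2,1) this cop]
    have "poly (complex_poly g) ?w \<in> \<real>"
      using cnj_g[of ?w] cnj_root[OF wn] by (simp add: h Reals_cnj_iff)
    then obtain x where x: "poly (complex_poly g) ?w = of_real x" by (auto elim: Reals_cases)
    obtain y where y: "r = of_real y" using r(2) by (auto elim: Reals_cases)
    have "(of_real (x ^ m) :: complex) = of_real (y ^ m)" using pow by (simp add: x y)
    then have "x ^ m = y ^ m" by (simp only: of_real_eq_iff)
    then have "x = y" by (rule real_power_odd_cancel[OF m])
    then show ?thesis by (simp add: x y)
  qed
  \<comment> \<open>The difference has \<open>totient n\<close> distinct roots but smaller degree,
    so \<open>g\<close> is the constant \<open>r\<close>, a rational coefficient.\<close>
  have "complex_poly g - [:r:] = 0"
  proof (rule ccontr)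
    assume "complex_poly g - [:r:] \<noteq> 0"
    then have "totient n \<le> Polynomial.degree (complex_poly g - [:r:])"
      using conj by (intro totient_le_degree[OF z]) auto
    also have "\<dots> \<le> Polynomial.degree g" using degree_diff_le_max[of "complex_poly g" "[:r:]"] by simp
    finally show False using deg by simp
  qed
  then have "r = Polynomial.coeff (complex_poly g) 0" by simp
  then show ?thesis by (simp add: coeff_map_poly)
qed

section \<open>Subfields of the complex numbers\<close>

lemma complex_ring_simps [simp]:
  "carrier complex_ring = UNIV"
  "x \<otimes>\<^bsub>complex_ring\<^esub> y = x * y"
  "x \<oplus>\<^bsub>complex_ring\<^esub> y = x + y"
  "\<one>\<^bsub>complex_ring\<^esub> = 1"
  "\<zero>\<^bsub>complex_ring\<^esub> = 0"
  by (simp_all add: ring_of_type_algebra_def)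

lemma field_complex_ring: "field complex_ring"
  by (rule field_from_type_algebra)

interpretation complex_domain: domain complex_ring
  using field_complex_ring by (rule field.axioms(1))

lemma complex_ring_a_inv [simp]: "\<ominus>\<^bsub>complex_ring\<^esub> x = - x"
  by (rule complex_domain.minus_equality) auto

lemma complex_ring_m_inv [simp]: "x \<noteq> 0 \<Longrightarrow> inv\<^bsub>complex_ring\<^esub> x = inverse x"
  by (rule complex_domain.comm_inv_char) auto

lemma complex_ring_nat_pow [simp]: "x [^]\<^bsub>complex_ring\<^esub> (k::nat) = x ^ k"
  by (induction k) (simp_all add: mult.commute)

text \<open>Closure under \<open>inverse\<close> may include zero because
  \<open>inverse 0 = 0\<close>.\<close>

lemma complex_subfieldI:
  assumes "1 \<in> K" "\<And>x. x \<in> K \<Longrightarrow> - x \<in> K" "\<And>x y. x \<in> K \<Longrightarrow> y \<in> K \<Longrightarrow> x + y \<in> K"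
    "\<And>x y. x \<in> K \<Longrightarrow> y \<in> K \<Longrightarrow> x * y \<in> K" "\<And>x. x \<in> K \<Longrightarrow> inverse x \<in> K"
  shows "subfield K complex_ring"
  using assms by (intro field.subfieldI'[OF field_complex_ring] complex_domain.subringI) auto

context
  fixes K :: "complex set"
  assumes K: "subfield K complex_ring"
begin

lemma subfield_one: "1 \<in> K"
  and subfield_zero: "0 \<in> K"
  and subfield_add: "x \<in> K \<Longrightarrow> y \<in> K \<Longrightarrow> x + y \<in> K"
  and subfield_mult: "x \<in> K \<Longrightarrow> y \<in> K \<Longrightarrow> x * y \<in> K"
  and subfield_uminus: "x \<in> K \<Longrightarrow> - x \<in> K"
  using subringE[OF subfieldE(1)[OF K]] by auto

lemma subfield_inverse: "x \<in> K \<Longrightarrow> inverse x \<in> K"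
  using complex_domain.subfield_m_inv(1)[OF K, of x] subfield_zero by (cases "x = 0") auto

lemma subfield_diff: "x \<in> K \<Longrightarrow> y \<in> K \<Longrightarrow> x - y \<in> K"
  using subfield_add[of x "- y"] subfield_uminus by simp

lemma subfield_divide: "x \<in> K \<Longrightarrow> y \<in> K \<Longrightarrow> x / y \<in> K"
  unfolding divide_inverse by (intro subfield_mult subfield_inverse)

lemma subfield_power: "x \<in> K \<Longrightarrow> x ^ k \<in> K"
  by (induction k) (auto intro: subfield_one subfield_mult)

lemma subfield_sum: "(\<And>i. i \<in> A \<Longrightarrow> g i \<in> K) \<Longrightarrow> sum g A \<in> K"
  by (induction A rule: infinite_finite_induct) (auto intro: subfield_zero subfield_add)

lemma Rats_subset_subfield: "\<rat> \<subseteq> K"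
proof
  fix x :: complex assume "x \<in> \<rat>"
  then obtain i j :: int where x: "x = of_int i / of_int j" by (auto elim!: Rats_cases')
  have nat: "of_nat m \<in> K" for m
    by (induction m) (auto intro: subfield_zero subfield_one subfield_add)
  have "of_int m \<in> K" for m
    using nat[of "nat m"] subfield_uminus[OF nat[of "nat (- m)"]] by (cases "m \<ge> 0") auto
  then show "x \<in> K" unfolding x by (intro subfield_divide)
qed

end

lemma subfield_Rats: "subfield \<rat> complex_ring"
  by (rule complex_subfieldI) auto

lemma adjoin_rat_subfield: "subfield (adjoin_rat S) complex_ring"
  unfolding adjoin_rat_def by (rule field.generate_field_is_subfield[OF field_complex_ring]) simp

lemma adjoin_rat_incl: "x \<in> S \<Longrightarrow> x \<in> adjoin_rat S"
  unfolding adjoin_rat_def by (rule generate_field.incl)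

lemma adjoin_rat_subsetI: "subfield K complex_ring \<Longrightarrow> S \<subseteq> K \<Longrightarrow> adjoin_rat S \<subseteq> K"
  unfolding adjoin_rat_def by (rule field.generate_field_min_subfield1[OF field_complex_ring]) auto

lemma adjoin_rat_mono: "S \<subseteq> T \<Longrightarrow> adjoin_rat S \<subseteq> adjoin_rat T"
  by (rule adjoin_rat_subsetI[OF adjoin_rat_subfield]) (auto intro: adjoin_rat_incl)

lemma adjoin_rat_subset_adjoin: "S \<subseteq> adjoin_rat T \<Longrightarrow> adjoin_rat S \<subseteq> adjoin_rat T"
  by (rule adjoin_rat_subsetI[OF adjoin_rat_subfield])

lemma adjoin_rat_empty: "adjoin_rat {} = \<rat>"
  using adjoin_rat_subsetI[OF subfield_Rats, of "{}"] Rats_subset_subfield[OF adjoin_rat_subfield] by auto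

section \<open>Polynomials over a subfield and the dimension of simple extensions\<close>

definition poly_over :: "complex set \<Rightarrow> complex poly set" where
  "poly_over K = {q. \<forall>i. Polynomial.coeff q i \<in> K}"

lemma poly_over_RatsE:
  assumes "q \<in> poly_over \<rat>"
  obtains g where "q = complex_poly g"
proof -
  have inv: "inv_into UNIV of_rat (of_rat y :: complex) = y" for y
    by (rule inv_f_f) (simp add: inj_def)
  \<comment> \<open>\<open>map_poly\<close> acts coefficientwise only for functions that fix
    zero.\<close>
  from inv[of 0] have inv0: "inv_into UNIV of_rat (0 :: complex) = 0" by simp
  have "q = complex_poly (map_poly (inv_into UNIV of_rat) q)"
  proof (rule poly_eqI)
    fix i
    obtain y where "Polynomial.coeff q i = of_rat y" using assms by (auto simp: poly_over_def elim: Rats_cases)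
    then show "Polynomial.coeff q i = Polynomial.coeff (complex_poly (map_poly (inv_into UNIV of_rat) q)) i"
      by (simp add: coeff_map_poly inv0 inv)
  qed
  then show ?thesis using that by blast
qed

lemma complex_poly_in_poly_over:
  "subfield K complex_ring \<Longrightarrow> complex_poly g \<in> poly_over K"
  using subsetD[OF Rats_subset_subfield] by (simp add: poly_over_def coeff_map_poly)

lemma poly_over_diff:
  "subfield K complex_ring \<Longrightarrow> p \<in> poly_over K \<Longrightarrow> q \<in> poly_over K \<Longrightarrow> p - q \<in> poly_over K"
  by (auto simp: poly_over_def intro: subfield_diff)

lemma poly_over_mult:
  "subfield K complex_ring \<Longrightarrow> p \<in> poly_over K \<Longrightarrow> q \<in> poly_over K \<Longrightarrow> p * q \<in> poly_over K"
  by (auto simp: poly_over_def coeff_mult intro!: subfield_sum subfield_mult)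

lemma poly_over_monom:
  "subfield K complex_ring \<Longrightarrow> x \<in> K \<Longrightarrow> Polynomial.monom x k \<in> poly_over K"
  by (auto simp: poly_over_def intro: subfield_zero)

text \<open>The inductive rules of \<open>simple_extension\<close> are Horner's scheme, so they
  correspond to \<open>pCons\<close>.\<close>

lemma simple_extension_eq_poly_image:
  assumes K: "subfield K complex_ring"
  shows "complex_domain.simple_extension K x = (\<lambda>q. poly q x) ` poly_over K"
proof (intro equalityI subsetI)
  fix y assume "y \<in> complex_domain.simple_extension K x"
  then show "y \<in> (\<lambda>q. poly q x) ` poly_over K"
  proof induction
    case zero
    show ?case by (rule image_eqI[of _ _ 0]) (auto simp: poly_over_def subfield_zero[OF K])
  next
    case (lin k1 k2)
    then obtain q where q: "q \<in> poly_over K" "k1 = poly q x" by auto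
    show ?case
      by (rule image_eqI[of _ _ "pCons k2 q"])
         (use q lin in \<open>auto simp: poly_over_def coeff_pCons split: nat.split\<close>)
  qed
next
  fix y assume "y \<in> (\<lambda>q. poly q x) ` poly_over K"
  then obtain q where "q \<in> poly_over K" and y: "y = poly q x" by auto
  then have "poly q x \<in> complex_domain.simple_extension K x"
  proof (induction q arbitrary: y)
    case 0 show ?case using complex_domain.simple_extension.zero by simp
  next
    case (pCons k q)
    have "k \<in> K" "q \<in> poly_over K"
      using pCons.prems(1) by (auto simp: poly_over_def coeff_pCons split: nat.splits)
    then show ?case
      using complex_domain.simple_extension.lin[of "poly q x" K x k] pCons.IH
      by (simp add: algebra_simps)
  qed
  then show "y \<in> complex_domain.simple_extension K x" by (simp add: y)
qed

lemma adjoin_rat_insert_eq_simple_extension: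
  assumes "subfield (complex_domain.simple_extension (adjoin_rat S) x) complex_ring"
  shows "adjoin_rat (insert x S) = complex_domain.simple_extension (adjoin_rat S) x"
proof
  have sub: "subring (adjoin_rat S) complex_ring" using adjoin_rat_subfield by (rule subfieldE(1))
  have "adjoin_rat S \<subseteq> complex_domain.simple_extension (adjoin_rat S) x"
    by (rule complex_domain.simple_extension_incl) auto
  then show "adjoin_rat (insert x S) \<subseteq> complex_domain.simple_extension (adjoin_rat S) x"
    using complex_domain.simple_extension_mem[OF sub, of x]
    by (intro adjoin_rat_subsetI assms) (auto intro: adjoin_rat_incl)
  show "complex_domain.simple_extension (adjoin_rat S) x \<subseteq> adjoin_rat (insert x S)"
    using subfieldE(1)[OF adjoin_rat_subfield[of "insert x S"]]
    by (intro complex_domain.simple_extension_subring_incl adjoin_rat_mono) (auto intro: adjoin_rat_incl)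
qed

text \<open>The list encoding of HOL-Algebra puts the leading coefficient first, whereas
  \<open>Poly\<close> expects the constant term first.\<close>

lemma complex_domain_eval_eq_poly: "complex_domain.eval p x = poly (Poly (rev p)) x"
  by (induction p) (simp_all add: Poly_append poly_monom mult.commute)

text \<open>HOL-Algebra gives the dimension through the length of the list polynomial
  \<open>Irr\<close>. Its degree agrees with that of \<open>m\<close>: each of the two is minimal,
  and each can be translated into the other encoding.\<close>

lemma complex_domain_dimension_simple_extension:
  assumes K: "subfield K complex_ring" and m: "m \<in> poly_over K" "m \<noteq> 0" "poly m x = 0"
    and min: "\<And>q. q \<in> poly_over K \<Longrightarrow> q \<noteq> 0 \<Longrightarrow> poly q x = 0 \<Longrightarrow> Polynomial.degree m \<le> Polynomial.degree q"
  shows "complex_domain.dimension (Polynomial.degree m) K (complex_domain.simple_extension K x)"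
    and "subfield (complex_domain.simple_extension K x) complex_ring"
proof -
  let ?p = "rev (Polynomial.coeffs m)"
  have "set (Polynomial.coeffs m) \<subseteq> K"
    using m(1) subset_insertI[of "set (Polynomial.coeffs m)" 0] unfolding range_coeff[symmetric] poly_over_def
    by blast
  then have p: "?p \<in> carrier (univ_poly complex_ring K)"
    unfolding univ_poly_carrier[symmetric] polynomial_def
    using last_coeffs_eq_coeff_degree[OF m(2)] m(2) by (simp add: hd_rev)
  have pe: "complex_domain.eval ?p x = \<zero>\<^bsub>complex_ring\<^esub>" using m by (simp add: complex_domain_eval_eq_poly)
  have p0: "?p \<noteq> []" using m by simp
  from p p0 pe have alg: "(complex_domain.algebraic over K) x" by (rule complex_domain.algebraicI)
  show "subfield (complex_domain.simple_extension K x) complex_ring"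
    using complex_domain.simple_extension_is_subfield[OF K] alg by simp
  define I where "I = complex_domain.Irr K x"
  have I: "I \<in> carrier (univ_poly complex_ring K)" "complex_domain.eval I x = 0"
    "pirreducible\<^bsub>complex_ring\<^esub> K I"
    using complex_domain.IrrE[OF K _ alg] by (simp_all add: I_def)
  have xc: "x \<in> carrier complex_ring" by simp
  from complex_domain.pdivides_imp_degree_le[OF subfieldE(1)[OF K] I(1) p p0
      complex_domain.Irr_minimal[OF K xc alg p pe, folded I_def]]
  have le: "length I - 1 \<le> Polynomial.degree m" by (simp add: degree_eq_length_coeffs)
  have "I \<noteq> []" using I(3) by (simp add: ring_irreducible_def univ_poly_zero)
  then have hd: "hd I \<noteq> 0" "set I \<subseteq> K"
    using I(1) unfolding univ_poly_carrier[symmetric] polynomial_def by simp_all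
  define q where "q = Poly (rev I)"
  \<comment> \<open>Since \<open>hd I\<close> is nonzero, \<open>Poly\<close> strips no entries and
    the degree can be read off the length of \<open>I\<close>.\<close>
  have cq: "Polynomial.coeffs q = rev I"
    using hd \<open>I \<noteq> []\<close> by (simp add: q_def coeffs_Poly strip_while_rev dropWhile_eq_self_iff)
  have "q \<noteq> 0" using cq \<open>I \<noteq> []\<close> by auto
  moreover have "range (Polynomial.coeff q) \<subseteq> K"
    using hd(2) subfield_zero[OF K] unfolding range_coeff cq by simp
  then have "q \<in> poly_over K" by (simp add: poly_over_def image_subset_iff)
  moreover have "poly q x = 0" using I(2) by (simp add: q_def complex_domain_eval_eq_poly)
  ultimately have "Polynomial.degree m \<le> length I - 1" using min[of q] by (simp add: degree_eq_length_coeffs cq)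
  with le complex_domain.dimension_simple_extension[OF K _ alg]
  show "complex_domain.dimension (Polynomial.degree m) K (complex_domain.simple_extension K x)"
    by (simp add: I_def)
qed

lemma
  assumes z: "primitive_root_of_unity n z"
  shows dimension_cyclotomic: "complex_domain.dimension (totient n) \<rat> (adjoin_rat {z})"
    and adjoin_rat_cyclotomic: "adjoin_rat {z} = (\<lambda>q. poly (complex_poly q) z) ` UNIV"
proof -
  obtain f where f: "f \<noteq> 0" "poly (complex_poly f) z = 0" "Polynomial.degree f = totient n"
    using rat_poly_degree_totient_exists[OF z] .
  have "Polynomial.degree (complex_poly f) \<le> Polynomial.degree q"
    if q: "q \<in> poly_over \<rat>" "q \<noteq> 0" "poly q z = 0" for q
  proof -
    obtain g where "q = complex_poly g" using poly_over_RatsE[OF q(1)] by blast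
    then show ?thesis using q f totient_le_degree_rat[OF z, of g] by simp
  qed
  with complex_domain_dimension_simple_extension[OF subfield_Rats, of "complex_poly f" z]
  have dim: "complex_domain.dimension (totient n) \<rat> (complex_domain.simple_extension \<rat> z)"
    and sub: "subfield (complex_domain.simple_extension \<rat> z) complex_ring"
    using f complex_poly_in_poly_over[OF subfield_Rats] by auto
  have eq: "adjoin_rat {z} = complex_domain.simple_extension \<rat> z"
    using adjoin_rat_insert_eq_simple_extension[of "{}" z] sub by (simp add: adjoin_rat_empty)
  show "complex_domain.dimension (totient n) \<rat> (adjoin_rat {z})" using dim by (simp add: eq)
  show "adjoin_rat {z} = (\<lambda>q. poly (complex_poly q) z) ` UNIV"
    unfolding eq simple_extension_eq_poly_image[OF subfield_Rats]
    using complex_poly_in_poly_over[OF subfield_Rats] by (auto elim: poly_over_RatsE)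
qed

text \<open>Long division one leading term at a time: each step subtracts a multiple of
  \<open>m\<close> whose coefficients stay in \<open>K\<close>, so minimality applies again to the
  remainder.\<close>

lemma minimal_poly_over_dvd:
  assumes K: "subfield K complex_ring" and m: "m \<in> poly_over K" "m \<noteq> 0" "poly m x = 0"
    and min: "\<And>q. q \<in> poly_over K \<Longrightarrow> q \<noteq> 0 \<Longrightarrow> poly q x = 0 \<Longrightarrow> Polynomial.degree m \<le> Polynomial.degree q"
  shows "q \<in> poly_over K \<Longrightarrow> poly q x = 0 \<Longrightarrow> m dvd q"
proof (induction "Polynomial.degree q" arbitrary: q rule: less_induct)
  case less
  show ?case
  proof (cases "q = 0")
    case False
    define s where "s = Polynomial.monom (Polynomial.lead_coeff q / Polynomial.lead_coeff m)
       (Polynomial.degree q - Polynomial.degree m)"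
    define r where "r = q - s * m"
    have le: "Polynomial.degree m \<le> Polynomial.degree q" using min less.prems False by auto
    have s: "s \<in> poly_over K" unfolding s_def
      using less.prems m by (intro poly_over_monom subfield_divide K) (auto simp: poly_over_def)
    have "Polynomial.degree (s * m) \<le> Polynomial.degree q"
      using le by (intro order.trans[OF degree_mult_le]) (auto simp: s_def intro!: order.trans[OF add_mono[OF degree_monom_le order.refl]])
    then have "Polynomial.degree r \<le> Polynomial.degree q" unfolding r_def by (intro degree_diff_le) auto
    moreover have "Polynomial.coeff r (Polynomial.degree q) = 0"
      using le m(2) by (simp add: r_def s_def coeff_monom_mult)
    ultimately have "r = 0 \<or> Polynomial.degree r < Polynomial.degree q"
      by (metis leading_coeff_0_iff le_neq_implies_less)
    moreover have "r \<in> poly_over K" unfolding r_def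
      using less.prems m s by (intro poly_over_diff poly_over_mult K)
    moreover have "poly r x = 0" using less.prems m by (simp add: r_def)
    ultimately have "m dvd r" using less.hyps by auto
    then have "m dvd r + s * m" by simp
    then show ?thesis by (simp add: r_def)
  qed simp
qed

lemma degree_rat_Rats: "degree_rat \<rat> = 1"
  using complex_domain.dimI[OF subfield_Rats complex_domain.dimension_one[OF subfield_Rats]]
  by (simp add: degree_rat_def over_def)

section \<open>Radical extensions by real roots\<close>

text \<open>This evaluates the constant term of a factor of \<open>x^n - c\<close>, a product of
  negated roots up to the leading coefficient. Multisets account for multiplicities.\<close>

lemma prod_uminus_scaled_roots_of_unity:
  fixes a z :: "'a::comm_ring_1"
  assumes "\<forall>x\<in>#A. \<exists>i. x = a * z ^ i"
  shows "\<exists>t. (\<Prod>x\<in>#A. - x) = (- a) ^ size A * z ^ t"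
  using assms
proof (induction A)
  case empty
  then show ?case by (auto intro: exI[of _ 0])
next
  case (add x A)
  then obtain t i where "(\<Prod>x\<in>#A. - x) = (- a) ^ size A * z ^ t" "x = a * z ^ i" by auto
  then have "(\<Prod>x\<in>#add_mset x A. - x) = (- a) ^ size (add_mset x A) * z ^ (i + t)"
    by (simp add: power_add mult_ac)
  then show ?case by blast
qed

lemma primitive_root_of_unity_div:
  assumes z: "primitive_root_of_unity n z" and M: "M dvd n"
  shows "primitive_root_of_unity M (z ^ (n div M))"
proof -
  have n: "n > 0" using z by (simp add: primitive_root_of_unity_def)
  then have M0: "M > 0" using M by (auto intro: Nat.gr0I)
  have nM: "n = n div M * M" using M by simp
  then have d0: "n div M > 0" using n by (metis mult_0 neq0_conv)
  have "(z ^ (n div M)) ^ m = 1 \<longleftrightarrow> M dvd m" for m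
  proof -
    have "(z ^ (n div M)) ^ m = 1 \<longleftrightarrow> n dvd n div M * m"
      using primitive_root_of_unity_power_eq_1_iff[OF z] by (simp flip: power_mult)
    also have "\<dots> \<longleftrightarrow> n div M * M dvd n div M * m" using nM by simp
    also have "\<dots> \<longleftrightarrow> M dvd m" using d0 by simp
    finally show ?thesis .
  qed
  then show ?thesis using M0 unfolding primitive_root_of_unity_def
    by (auto dest: dvd_imp_le)
qed

lemma poly_dvd_root:
  fixes p q :: "'a::comm_ring_1 poly"
  shows "p dvd q \<Longrightarrow> poly p x = 0 \<Longrightarrow> poly q x = 0"
  by (auto elim: dvdE)

lemma div_dvd_div_of_dvd:
  fixes x y n :: nat
  assumes "x dvd y" "y dvd n" "n > 0"
  shows "n div y dvd n div x"
proof -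
  obtain u where y: "y = x * u" using assms(1) by blast
  obtain v where n: "n = y * v" using assms(2) by blast
  have "n = x * (u * v)" by (simp only: n y mult.assoc)
  moreover have "x > 0" "y > 0" using assms n y by (auto intro: Nat.gr0I)
  ultimately have "n div x = u * v" "n div y = v" using n by (metis nonzero_mult_div_cancel_left less_irrefl)+
  then show ?thesis by simp
qed

text \<open>The root \<open>a\<close> is real, but the lemmas below also treat arbitrary complex
  roots \<open>b\<close>, because the first field of the tower is generated by a root other than
  \<open>a\<close>.\<close>

locale real_radical_extension =
  fixes n :: nat and c :: rat and z a :: complex
  assumes n_odd: "odd n"
    and z: "primitive_root_of_unity n z"
    and irreducible: "Factorial_Ring.irreducible (Polynomial.monom 1 n - [:c:])"
    and a_real: "a \<in> \<real>"
    and a_nonzero: "a \<noteq> 0"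
    and a_power: "a ^ n = of_rat c"
begin

lemma n_pos: "n > 0" and z_power: "z ^ n = 1"
  using z by (simp_all add: primitive_root_of_unity_def)

lemma z_nonzero: "z \<noteq> 0"
  using z_power n_pos by (metis zero_neq_one zero_power)

lemma root_nonzero:
  fixes b :: complex
  assumes "b ^ n = of_rat c"
  shows "b \<noteq> 0"
proof
  assume "b = 0"
  then have "a ^ n = 0" using assms a_power n_pos by (simp add: zero_power)
  then show False using a_nonzero by simp
qed

lemma roots_eq:
  assumes b: "b ^ n = of_rat c"
  shows "{w :: complex. w ^ n = of_rat c} = (\<lambda>i. b * z ^ i) ` {0<..n}"
proof (intro equalityI subsetI)
  fix w assume "w \<in> {w :: complex. w ^ n = of_rat c}"
  then have "w ^ n = b ^ n" using b by simp
  then have "(w / b) ^ n = 1" using root_nonzero[OF b] unfolding power_divide by simp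
  then have "w / b \<in> (\<lambda>i. z ^ i) ` {0<..n}" unfolding roots_of_unity_eq_powers[OF z, symmetric] by simp
  then obtain i where "i \<in> {0<..n}" "w / b = z ^ i" by blast
  then show "w \<in> (\<lambda>i. b * z ^ i) ` {0<..n}"
    using root_nonzero[OF b] by (auto simp: field_simps)
next
  fix w assume "w \<in> (\<lambda>i. b * z ^ i) ` {0<..n}"
  then obtain i where w: "w = b * z ^ i" by blast
  have "(z ^ i) ^ n = 1" using z_power by (metis mult.commute power_mult power_one)
  then show "w \<in> {w :: complex. w ^ n = of_rat c}" using b by (simp add: w power_mult_distrib)
qed

lemma minimal_rat_poly_dvd:
  assumes "poly (complex_poly g) a = 0"
  shows "Polynomial.monom 1 n - [:c:] dvd g"
proof (rule ccontr)
  assume "\<not> ?thesis"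
  moreover have "prime_elem (Polynomial.monom 1 n - [:c:])"
    using irreducible by (simp add: prime_elem_iff_irreducible)
  ultimately have "coprime (Polynomial.monom 1 n - [:c:]) g"
    by (rule prime_elem_imp_coprime[rotated])
  then have "gcd (Polynomial.monom 1 n - [:c:]) g = 1" by (simp add: coprime_iff_gcd_eq_1)
  moreover have "poly (complex_poly (gcd (Polynomial.monom 1 n - [:c:]) g)) a = 0"
    using assms a_power by (intro poly_complex_poly_gcd) (simp_all add: complex_poly_monom_minus_const poly_monom)
  ultimately show False by simp
qed

text \<open>For the uniqueness behind \<open>THE\<close>, another irreducible \<open>p\<close> with
  root \<open>a\<close> is a multiple of \<open>x^n - c\<close>. The cofactor is a unit, and
  comparing leading coefficients makes it 1.\<close>

lemma min_poly_rat_eq: "min_poly_rat a = Polynomial.monom 1 n - [:c:]"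
  unfolding min_poly_rat_def
proof (rule the_equality)
  let ?f = "Polynomial.monom 1 n - [:c:]"
  have lc: "Polynomial.lead_coeff ?f = 1"
    using n_pos by (simp add: degree_monom_minus_const coeff_pCons split: nat.split)
  then show "Polynomial.lead_coeff ?f = 1 \<and> Factorial_Ring.irreducible ?f \<and> a \<in> complex_roots ?f"
    using irreducible a_power by (simp add: complex_roots_def complex_poly_monom_minus_const poly_monom)
  fix p :: "rat poly"
  assume p: "Polynomial.lead_coeff p = 1 \<and> Factorial_Ring.irreducible p \<and> a \<in> complex_roots p"
  then obtain u where u: "p = ?f * u" using minimal_rat_poly_dvd[of p] by (auto simp: complex_roots_def)
  moreover have "\<not> ?f dvd 1" using irreducible by (simp add: irreducible_def)
  ultimately have "u dvd 1" using p irreducibleD[of p ?f u] by blast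
  then obtain k where k: "u = [:k:]" by (auto simp: is_unit_poly_iff)
  have "Polynomial.lead_coeff ?f * Polynomial.lead_coeff u = 1"
    using p unfolding u lead_coeff_mult by simp
  then have "k = 1" unfolding lc k by simp
  then show "p = ?f" using u k by simp
qed

lemma complex_roots_eq: "complex_roots (Polynomial.monom 1 n - [:c:]) = {w :: complex. w ^ n = of_rat c}"
  by (simp add: complex_roots_def complex_poly_monom_minus_const poly_monom)

text \<open>Suppose the minimal polynomial of \<open>b\<close> over the cyclotomic field had degree
  \<open>d < n\<close>. It divides \<open>x^n - c\<close>, so its constant term puts
  \<open>a ^ d\<close> into that field; being real with rational \<open>n\<close>-th power,
  \<open>a ^ d\<close> is rational, which is impossible.\<close>

lemma degree_over_cyclotomic_ge:
  assumes b: "b ^ n = of_rat c"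
    and q: "q \<in> poly_over (adjoin_rat {z})" "q \<noteq> 0" "poly q b = 0"
  shows "n \<le> Polynomial.degree q"
proof (rule ccontr)
  assume less: "\<not> n \<le> Polynomial.degree q"
  let ?K = "adjoin_rat {z}"
  let ?P = "\<lambda>q. q \<in> poly_over ?K \<and> q \<noteq> 0 \<and> poly q b = 0"
  have K: "subfield ?K complex_ring" by (rule adjoin_rat_subfield)
  obtain m where m: "?P m" and min: "\<And>q. ?P q \<Longrightarrow> Polynomial.degree m \<le> Polynomial.degree q"
    using ex_has_least_nat[of ?P q Polynomial.degree] q by blast
  define d where "d = Polynomial.degree m"
  have "d < n" using min[of q] q less by (simp add: d_def)
  have "d > 0"
  proof (rule Nat.gr0I)
    assume "d = 0"
    then obtain k where "m = [:k:]" unfolding d_def by (metis degree_eq_zeroE)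
    then show False using m by auto
  qed
  have "complex_poly (Polynomial.monom 1 n - [:c:]) \<in> poly_over ?K" by (rule complex_poly_in_poly_over[OF K])
  moreover have "poly (complex_poly (Polynomial.monom 1 n - [:c:])) b = 0"
    using b by (simp add: complex_poly_monom_minus_const poly_monom)
  ultimately have dvd: "m dvd complex_poly (Polynomial.monom 1 n - [:c:])"
    using m min by (intro minimal_poly_over_dvd[OF K, of m b]) auto
  have "\<exists>i. x = a * z ^ i" if "x \<in># proots m" for x
  proof -
    have "poly m x = 0" using that m by simp
    then have "x \<in> {w :: complex. w ^ n = of_rat c}"
      using poly_dvd_root[OF dvd] by (simp add: complex_poly_monom_minus_const poly_monom)
    then show ?thesis unfolding roots_eq[OF a_power] by blast
  qed
  then obtain t where t: "(\<Prod>x\<in>#proots m. - x) = (- a) ^ size (proots m) * z ^ t"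
    using prod_uminus_scaled_roots_of_unity[of "proots m" a z] by blast
  \<comment> \<open>Evaluating the factorization of \<open>m\<close> into linear factors at 0
    isolates the product of the negated roots.\<close>
  have "Polynomial.lead_coeff m * (\<Prod>x\<in>#proots m. - x) = poly m 0"
    using arg_cong[OF complex_poly_decompose_multiset[of m], of "\<lambda>p. poly p 0"]
    by (simp add: poly_prod_mset multiset.map_comp o_def)
  moreover have "size (proots m) = d" unfolding d_def by (rule size_proots_complex)
  ultimately have m0: "Polynomial.lead_coeff m * ((- a) ^ d * z ^ t) = Polynomial.coeff m 0"
    using t by (simp add: poly_0_coeff_0)
  have coeffs: "Polynomial.coeff m i \<in> ?K" for i using m by (simp add: poly_over_def)
  have zK: "z \<in> ?K" by (rule adjoin_rat_incl) simp
  have "(- a) ^ d = Polynomial.coeff m 0 / (Polynomial.lead_coeff m * z ^ t)"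
    using m z_nonzero unfolding m0[symmetric] by (simp add: nonzero_eq_divide_eq mult_ac)
  also have "\<dots> \<in> ?K"
    by (intro subfield_divide[OF K] subfield_mult[OF K] subfield_power[OF K] coeffs zK)
  \<comment> \<open>The extra factor removes the sign, leaving the real number
    \<open>a ^ d\<close>.\<close>
  finally have "(- 1) ^ d * (- a) ^ d \<in> ?K"
    by (rule subfield_mult[OF K subfield_power[OF K subfield_uminus[OF K subfield_one[OF K]]]])
  moreover have "(- 1) ^ d * (- a) ^ d = a ^ d" unfolding power_mult_distrib[symmetric] by simp
  ultimately have "a ^ d \<in> ?K" by simp
  then obtain q where q: "a ^ d = poly (complex_poly q) z" unfolding adjoin_rat_cyclotomic[OF z] by blast
  have "(a ^ d) ^ n = of_rat (c ^ d)"
    using a_power by (metis mult.commute of_rat_power power_mult)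
  then have "(a ^ d) ^ n \<in> \<rat>" by simp
  with real_radical_in_cyclotomic_field_is_rat[OF z q _ n_odd] a_real have "a ^ d \<in> \<rat>"
    by (simp add: Reals_power)
  then obtain s where s: "a ^ d = of_rat s" by (auto elim: Rats_cases)
  \<comment> \<open>A rational \<open>a ^ d\<close> makes \<open>a\<close> a root of a rational
    polynomial of degree \<open>d\<close>, against the irreducibility of
    \<open>x^n - c\<close>.\<close>
  have "Polynomial.monom 1 n - [:c:] dvd Polynomial.monom 1 d - [:s:]"
    using s by (intro minimal_rat_poly_dvd) (simp add: complex_poly_monom_minus_const poly_monom)
  moreover have "Polynomial.monom 1 d - [:s:] \<noteq> 0"
    using degree_monom_minus_const[OF \<open>d > 0\<close>, of s] \<open>d > 0\<close> by auto
  ultimately have "n \<le> d"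
    using dvd_imp_degree_le[of "Polynomial.monom 1 n - [:c:]" "Polynomial.monom 1 d - [:s:]"]
      n_pos \<open>d > 0\<close> by (simp add: degree_monom_minus_const)
  then show False using \<open>d < n\<close> by simp
qed

section \<open>The fields generated by one root of \<open>x^n - c\<close> and the
  \<open>M\<close>-th roots of unity, for \<open>M\<close> dividing \<open>n\<close>\<close>

definition root_extension :: "complex \<Rightarrow> nat \<Rightarrow> complex set" where
  "root_extension b M = adjoin_rat {b, z ^ (n div M)}"

lemma root_extension_subfield: "subfield (root_extension b M) complex_ring"
  unfolding root_extension_def by (rule adjoin_rat_subfield)

text \<open>The cyclotomic part contributes \<open>totient M\<close>. Adjoining \<open>b\<close>
  contributes the full \<open>n\<close>, since \<open>b\<close> has degree at least \<open>n\<close>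
  even over the larger field generated by \<open>z\<close>.\<close>

lemma degree_root_extension:
  assumes b: "b ^ n = of_rat c" and M: "M dvd n"
  shows "degree_rat (root_extension b M) = n * totient M"
proof -
  let ?w = "z ^ (n div M)"
  let ?K = "adjoin_rat {?w}"
  let ?f = "complex_poly (Polynomial.monom 1 n - [:c:])"
  have K: "subfield ?K complex_ring" by (rule adjoin_rat_subfield)
  have w: "primitive_root_of_unity M ?w" by (rule primitive_root_of_unity_div[OF z M])
  have "?w \<in> adjoin_rat {z}"
    by (intro subfield_power[OF adjoin_rat_subfield] adjoin_rat_incl) simp
  then have sub: "?K \<subseteq> adjoin_rat {z}" by (intro adjoin_rat_subset_adjoin) simp
  have deg: "Polynomial.degree ?f = n" using n_pos by (simp add: degree_monom_minus_const)
  have f: "?f \<in> poly_over ?K" "?f \<noteq> 0" "poly ?f b = 0"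
    using complex_poly_in_poly_over[OF K, of "Polynomial.monom 1 n - [:c:]"] b deg n_pos
    by (auto simp: complex_poly_monom_minus_const poly_monom simp del: degree_complex_poly)
  have min: "Polynomial.degree ?f \<le> Polynomial.degree q"
    if "q \<in> poly_over ?K" "q \<noteq> 0" "poly q b = 0" for q
    unfolding deg using that sub by (intro degree_over_cyclotomic_ge[OF b]) (auto simp: poly_over_def)
  have dim: "complex_domain.dimension n ?K (complex_domain.simple_extension ?K b)"
    by (rule complex_domain_dimension_simple_extension(1)[OF K f, unfolded deg]) (rule min[unfolded deg])
  have sf: "subfield (complex_domain.simple_extension ?K b) complex_ring"
    by (rule complex_domain_dimension_simple_extension(2)[OF K f]) (rule min)
  have "complex_domain.dimension n ?K (root_extension b M)"
    using dim unfolding root_extension_def adjoin_rat_insert_eq_simple_extension[OF sf] .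
  from complex_domain.telescopic_base[OF subfield_Rats K dimension_cyclotomic[OF w] this]
  have "complex_domain.dimension (totient M * n) \<rat> (root_extension b M)" .
  from complex_domain.dimI[OF subfield_Rats this] show ?thesis
    by (simp add: degree_rat_def over_def mult.commute)
qed

text \<open>A further power of \<open>z\<close> would enlarge the order of the available roots of
  unity from \<open>M\<close> to \<open>M t\<close> without changing the field. The degree formula
  then gives \<open>totient t = 1\<close>, and \<open>t\<close> is odd.\<close>

lemma power_in_root_extension_iff:
  assumes b: "b ^ n = of_rat c" and M: "M dvd n" and sqf: "squarefree n"
  shows "z ^ i \<in> root_extension b M \<longleftrightarrow> n div M dvd i"
proof
  note E = root_extension_subfield[of b M]
  let ?d = "n div M"
  have wE: "z ^ ?d \<in> root_extension b M" unfolding root_extension_def by (rule adjoin_rat_incl) simp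
  assume "n div M dvd i"
  then obtain l where "i = ?d * l" by blast
  then show "z ^ i \<in> root_extension b M"
    using subfield_power[OF E wE, of l] by (simp add: power_mult)
next
  note E = root_extension_subfield[of b M]
  let ?d = "n div M"
  have wE: "z ^ ?d \<in> root_extension b M" unfolding root_extension_def by (rule adjoin_rat_incl) simp
  have bE: "b \<in> root_extension b M" unfolding root_extension_def by (rule adjoin_rat_incl) simp
  assume i: "z ^ i \<in> root_extension b M"
  show "n div M dvd i"
  proof (cases "i = 0")
    case False
    define e where "e = gcd i ?d"
    \<comment> \<open>Bezout turns membership of \<open>z ^ i\<close> and
      \<open>z ^ (n div M)\<close> into membership of the power with the gcd as exponent.
      \<open>bezout_nat\<close> requires a nonzero argument, hence the separate case
      \<open>i = 0\<close>.\<close>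
    obtain x y where xy: "i * x = ?d * y + e" using bezout_nat[OF False, of ?d] unfolding e_def by auto
    have "z ^ e = (z ^ i) ^ x / (z ^ ?d) ^ y"
      using z_nonzero xy by (simp add: field_simps flip: power_mult power_add)
    then have eE: "z ^ e \<in> root_extension b M"
      using subfield_divide[OF E subfield_power[OF E i] subfield_power[OF E wE]] by simp
    have nM: "n = M * ?d" using M by simp
    obtain t where t: "?d = e * t" unfolding e_def by (metis gcd_dvd2 dvdE)
    have n_eq: "n = e * (M * t)" using nM t by (simp add: mult_ac)
    have pos: "e > 0" "M > 0" "t > 0" using n_pos n_eq by (auto intro: Nat.gr0I)
    have e: "n div (M * t) = e" using n_eq pos by simp
    have "root_extension b (M * t) \<subseteq> root_extension b M"
      unfolding root_extension_def[of b "M * t"] e by (rule adjoin_rat_subsetI[OF E]) (use bE eE in auto)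
    moreover have "root_extension b M \<subseteq> root_extension b (M * t)"
    proof -
      have "z ^ e \<in> root_extension b (M * t)" "b \<in> root_extension b (M * t)"
        unfolding root_extension_def e by (auto intro: adjoin_rat_incl)
      moreover have "z ^ ?d = (z ^ e) ^ t" unfolding t by (simp add: power_mult)
      ultimately show ?thesis
        unfolding root_extension_def[of b M]
        using subfield_power[OF root_extension_subfield] by (intro adjoin_rat_subsetI root_extension_subfield) auto
    qed
    ultimately have "n * totient (M * t) = n * totient M"
      using degree_root_extension[OF b M] degree_root_extension[OF b, of "M * t"] n_eq by auto
    \<comment> \<open>Squarefreeness of \<open>n\<close> makes the totient multiplicative on
      \<open>M * t\<close>.\<close>
    moreover have "coprime M t"
    proof (rule coprimeI)
      fix r assume "r dvd M" "r dvd t"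
      then have "r ^ 2 dvd M * t" unfolding power2_eq_square by (rule mult_dvd_mono)
      then have "r ^ 2 dvd n" using n_eq by simp
      then show "r dvd 1" using sqf by (auto simp: squarefree_def)
    qed
    ultimately have "totient t = 1" using n_pos pos by (simp add: totient_mult_coprime)
    then have "t \<le> 2" using totient_gt_1[of t] by (cases "2 < t") auto
    moreover have "odd t" using n_odd n_eq by simp
    ultimately have "t = 1" using pos by (cases "t = 2") auto
    then have "?d = e" using t by simp
    then show ?thesis unfolding e_def by (metis gcd_dvd1)
  qed simp
qed

text \<open>Dividing by \<open>b\<close> turns the roots lying in the field into the
  \<open>n\<close>-th roots of unity lying in it, and these are exactly the \<open>M\<close>-th
  roots of unity.\<close>

lemma card_roots_in_root_extension:
  assumes b: "b ^ n = of_rat c" and M: "M dvd n" and sqf: "squarefree n"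
  shows "card ({w :: complex. w ^ n = of_rat c} \<inter> root_extension b M) = M"
proof -
  note E = root_extension_subfield[of b M]
  let ?d = "n div M"
  have nM: "n = ?d * M" using M by simp
  have M0: "M > 0" using n_pos M by (auto intro: Nat.gr0I)
  have b0: "b \<noteq> 0" by (rule root_nonzero[OF b])
  have bE: "b \<in> root_extension b M" unfolding root_extension_def by (rule adjoin_rat_incl) simp
  have "{w :: complex. w ^ n = of_rat c} \<inter> root_extension b M = (\<lambda>u. b * u) ` {u. u ^ M = 1}"
  proof (intro equalityI subsetI)
    fix w assume w: "w \<in> {w :: complex. w ^ n = of_rat c} \<inter> root_extension b M"
    then obtain i where i: "w = b * z ^ i" unfolding roots_eq[OF b] by blast
    then have "w / b = z ^ i" using b0 by simp
    moreover have "w / b \<in> root_extension b M" using w bE by (intro subfield_divide[OF E]) auto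
    ultimately have "?d dvd i" using power_in_root_extension_iff[OF b M sqf] by simp
    then obtain l where "i = ?d * l" by blast
    then have "i * M = n * l" using nM by (simp add: mult_ac)
    then have "(z ^ i) ^ M = (z ^ n) ^ l" by (simp only: power_mult[symmetric])
    then have "(z ^ i) ^ M = 1" using z_power by simp
    then show "w \<in> (\<lambda>u. b * u) ` {u. u ^ M = 1}" using i by blast
  next
    fix w assume "w \<in> (\<lambda>u. b * u) ` {u. u ^ M = 1}"
    then obtain u where u: "w = b * u" "u ^ M = 1" by blast
    have "u ^ n = (u ^ M) ^ ?d" using nM by (metis mult.commute power_mult)
    then have "u ^ n = 1" using u by simp
    then have wn: "w ^ n = of_rat c" using b u by (simp add: power_mult_distrib)
    have "u \<in> (\<lambda>i. (z ^ ?d) ^ i) ` {0<..M}"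
      using u roots_of_unity_eq_powers[OF primitive_root_of_unity_div[OF z M]] by auto
    then obtain i where "u = z ^ (?d * i)" by (auto simp: power_mult)
    then have "u \<in> root_extension b M" using power_in_root_extension_iff[OF b M sqf] by simp
    then show "w \<in> {w :: complex. w ^ n = of_rat c} \<inter> root_extension b M"
      using wn u bE subfield_mult[OF E] by auto
  qed
  moreover have "inj_on (\<lambda>u. b * u) A" for A using b0 by (simp add: inj_on_def)
  ultimately show ?thesis using M0 by (simp add: card_image card_roots_unity_eq)
qed

text \<open>Roots of unity of coprime orders \<open>x\<close> and \<open>y\<close> generate one of
  order \<open>x * y\<close>. Bezout over the naturals yields it as a quotient of powers.\<close>

lemma power_div_coprime_mult_mem:
  assumes F: "subfield F complex_ring" and xy: "coprime x y" "x * y dvd n"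
    and x: "z ^ (n div x) \<in> F" and y: "z ^ (n div y) \<in> F"
  shows "z ^ (n div (x * y)) \<in> F"
proof -
  obtain w where n: "n = x * y * w" using xy(2) by blast
  have pos: "x > 0" "y > 0" using n n_pos by (auto intro: Nat.gr0I)
  have nx: "n div x = y * w" and ny: "n div y = x * w" and nxy: "n div (x * y) = w"
    using pos by (simp_all add: n mult_ac)
  obtain u v where "y * u = x * v + gcd y x" using bezout_nat[of y x] pos by auto
  then have uv: "y * u = x * v + 1" using xy(1) by (simp add: gcd.commute)
  have "y * w * u = (y * u) * w" by (simp only: mult_ac)
  also have "\<dots> = w + x * w * v" unfolding uv by (simp add: algebra_simps)
  finally have "(z ^ (y * w)) ^ u = z ^ w * (z ^ (x * w)) ^ v"
    by (simp only: power_mult[symmetric] power_add[symmetric])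
  then have "z ^ w = (z ^ (y * w)) ^ u / (z ^ (x * w)) ^ v"
    using z_nonzero by simp
  then show ?thesis
    using subfield_divide[OF F subfield_power[OF F x] subfield_power[OF F y]] nx ny nxy by simp
qed

lemma power_div_prod_mem:
  assumes F: "subfield F complex_ring" and "finite J"
    and "\<And>i j. i \<in> J \<Longrightarrow> j \<in> J \<Longrightarrow> i \<noteq> j \<Longrightarrow> coprime (p i) (p j :: nat)"
    and "(\<Prod>j\<in>J. p j) dvd n" and "\<And>j. j \<in> J \<Longrightarrow> z ^ (n div p j) \<in> F"
  shows "z ^ (n div (\<Prod>j\<in>J. p j)) \<in> F"
  using assms(2-)
proof (induction J rule: finite_induct)
  case empty
  then show ?case using z_power subfield_one[OF F] by simp
next
  case (insert i J)
  have cop: "coprime (p i) (\<Prod>j\<in>J. p j)"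
    using insert.hyps insert.prems(1) by (intro prod_coprime_right) auto
  have dvd: "p i * (\<Prod>j\<in>J. p j) dvd n" using insert.hyps insert.prems(2) by simp
  have "z ^ (n div (\<Prod>j\<in>J. p j)) \<in> F"
    using insert.prems dvd_mult_right[OF dvd] by (intro insert.IH) auto
  with power_div_coprime_mult_mem[OF F cop dvd] insert.prems(3)
  show ?case using insert.hyps by simp
qed

text \<open>
  The quotient of two generators is a root of unity of order \<open>p s * p t\<close>; its \<open>p t\<close>-th power
  generates the \<open>p s\<close>-th roots of unity, which splits off \<open>a\<close>.
\<close>
lemma adjoin_radicals_eq_root_extension:
  assumes J: "finite J" "s \<in> J" "t \<in> J" "s \<noteq> t"
    and cop: "\<And>i j. i \<in> J \<Longrightarrow> j \<in> J \<Longrightarrow> i \<noteq> j \<Longrightarrow> coprime (p i) (p j)"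
    and dvd: "(\<Prod>j\<in>J. p j) dvd n"
  shows "adjoin_rat ((\<lambda>j. a * z ^ (n div p j)) ` J) = root_extension a (\<Prod>j\<in>J. p j)"
proof
  note E = root_extension_subfield[of a "\<Prod>j\<in>J. p j"]
  let ?F = "adjoin_rat ((\<lambda>j. a * z ^ (n div p j)) ` J)"
  have F: "subfield ?F complex_ring" by (rule adjoin_rat_subfield)
  have aE: "a \<in> root_extension a (\<Prod>j\<in>J. p j)"
    and zE: "z ^ (n div (\<Prod>j\<in>J. p j)) \<in> root_extension a (\<Prod>j\<in>J. p j)"
    unfolding root_extension_def by (simp_all add: adjoin_rat_incl)
  have "a * z ^ (n div p j) \<in> root_extension a (\<Prod>j\<in>J. p j)" if "j \<in> J" for j
  proof -
    have "p j dvd (\<Prod>j\<in>J. p j)" using J(1) that by (rule dvd_prodI)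
    from div_dvd_div_of_dvd[OF this dvd n_pos]
    obtain u where "n div p j = n div (\<Prod>j\<in>J. p j) * u" by blast
    then have "z ^ (n div p j) = (z ^ (n div (\<Prod>j\<in>J. p j))) ^ u" by (simp only: power_mult)
    then show ?thesis using subfield_mult[OF E aE subfield_power[OF E zE]] by simp
  qed
  then show "?F \<subseteq> root_extension a (\<Prod>j\<in>J. p j)"
    by (intro adjoin_rat_subsetI[OF E]) auto
  have gen: "a * z ^ (n div p j) \<in> ?F" if "j \<in> J" for j
    using that by (intro adjoin_rat_incl imageI)
  have pdvd: "p j dvd n" if "j \<in> J" for j
    using dvd_prodI[OF J(1) that, of p] dvd by (rule dvd_trans)
  have pos: "p j > 0" if "j \<in> J" for j using pdvd[OF that] n_pos by (auto intro: Nat.gr0I)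
  have "(a * z ^ (n div p s) / (a * z ^ (n div p t))) ^ p t \<in> ?F"
    by (intro subfield_power[OF F] subfield_divide[OF F] gen J)
  also have "(a * z ^ (n div p s) / (a * z ^ (n div p t))) ^ p t = (z ^ (n div p s)) ^ p t / (z ^ (n div p t)) ^ p t"
    using a_nonzero by (simp add: power_divide)
  also have "(z ^ (n div p t)) ^ p t = 1"
    using pdvd[OF J(3)] z_power by (simp flip: power_mult)
  finally have quot: "(z ^ (n div p s)) ^ p t \<in> ?F" by simp
  obtain u v where "p t * u = p s * v + gcd (p t) (p s)" using bezout_nat[of "p t" "p s"] pos[OF J(3)] by auto
  then have uv: "p t * u = p s * v + 1" using cop[of t s] J by simp
  have "((z ^ (n div p s)) ^ p t) ^ u = (z ^ (n div p s)) ^ (p s * v + 1)"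
    by (simp only: power_mult[symmetric] uv mult.assoc)
  also have "\<dots> = ((z ^ (n div p s)) ^ p s) ^ v * z ^ (n div p s)" by (simp only: power_add power_mult power_one_right)
  also have "(z ^ (n div p s)) ^ p s = 1"
    using pdvd[OF J(2)] z_power by (simp flip: power_mult)
  finally have zs: "z ^ (n div p s) \<in> ?F" using subfield_power[OF F quot, of u] by simp
  have "a = a * z ^ (n div p s) / z ^ (n div p s)" using z_nonzero by simp
  then have aF: "a \<in> ?F" using subfield_divide[OF F gen[OF J(2)] zs] by simp
  have "z ^ (n div p j) \<in> ?F" if "j \<in> J" for j
    using subfield_divide[OF F gen[OF that] aF] a_nonzero by simp
  then have "z ^ (n div (\<Prod>j\<in>J. p j)) \<in> ?F"
    using J(1) cop dvd by (intro power_div_prod_mem[OF F]) auto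
  then show "root_extension a (\<Prod>j\<in>J. p j) \<subseteq> ?F"
    unfolding root_extension_def using aF by (intro adjoin_rat_subsetI[OF F]) auto
qed

text \<open>For \<open>M = 1\<close> the adjoined root of unity is \<open>z ^ n = 1\<close>. This
  brings the first field of the tower under the general degree and counting results.\<close>

lemma adjoin_root_eq_root_extension: "adjoin_rat {b} = root_extension b 1"
proof
  show "adjoin_rat {b} \<subseteq> root_extension b 1"
    unfolding root_extension_def by (intro adjoin_rat_mono) auto
  show "root_extension b 1 \<subseteq> adjoin_rat {b}"
    unfolding root_extension_def using z_power subfield_one[OF adjoin_rat_subfield]
    by (intro adjoin_rat_subsetI[OF adjoin_rat_subfield]) (auto intro: adjoin_rat_incl)
qed

lemma splitting_field_rat_eq:
  "splitting_field_rat (Polynomial.monom 1 n - [:c:]) = adjoin_rat {a, z}"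
  unfolding splitting_field_rat_def complex_roots_eq
proof
  let ?E = "adjoin_rat {a, z}" and ?R = "{w :: complex. w ^ n = of_rat c}"
  have "a \<in> ?E" "z \<in> ?E" by (simp_all add: adjoin_rat_incl)
  then have "a * z ^ i \<in> ?E" for i
    by (intro subfield_mult[OF adjoin_rat_subfield] subfield_power[OF adjoin_rat_subfield])
  then show "adjoin_rat ?R \<subseteq> ?E"
    unfolding roots_eq[OF a_power] by (intro adjoin_rat_subsetI[OF adjoin_rat_subfield]) auto
  have "a \<in> adjoin_rat ?R" "a * z \<in> adjoin_rat ?R"
    using a_power z_power by (simp_all add: adjoin_rat_incl power_mult_distrib)
  then have "z \<in> adjoin_rat ?R"
    using subfield_divide[OF adjoin_rat_subfield, of "a * z" ?R a] a_nonzero by simp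
  with \<open>a \<in> adjoin_rat ?R\<close> show "?E \<subseteq> adjoin_rat ?R"
    by (intro adjoin_rat_subsetI[OF adjoin_rat_subfield]) auto
qed

end

section \<open>The cluster tower of \<open>x^n - c\<close>\<close>

theorem proposition2p10:
  fixes k n :: nat and p :: "nat \<Rightarrow> nat" and \<zeta> a :: complex and c :: rat
    and f :: "rat poly" and bs :: "complex list" and L :: "nat \<Rightarrow> complex set"
  assumes k: "k > 2"
    and p_prime: "\<forall>i\<in>{1..k}. Factorial_Ring.prime (p i) \<and> odd (p i)"
    and p_distinct: "inj_on p {1..k}"
    and n: "n = (\<Prod>j=1..k. p j)"
    and \<zeta>: "primitive_root_of_unity n \<zeta>"
    and c: "c > 0"
    and f: "f = Polynomial.monom 1 n - [:c:]"
    and f_irreducible: "Factorial_Ring.irreducible f"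
    and a: "a = complex_of_real (root n (real_of_rat c))"
    and bs: "bs = map (\<lambda>i. a * \<zeta> ^ (n div p i)) [1..<Suc k]"
    and L: "\<forall>i. L i = adjoin_rat ((\<lambda>j. a * \<zeta> ^ (n div p j)) ` {1..i})"
  shows "splitting_field_rat f = adjoin_rat {a, \<zeta>} \<and>
     distinct bs \<and> minimal_generating_set f (set bs) \<and>
     cluster_tower bs = \<rat> # map L [1..<Suc k] \<and>
     L k = splitting_field_rat f \<and>
     tower_length (cluster_tower bs) = k \<and>
     (\<forall>i\<in>{2..k}. L i = adjoin_rat {a, \<zeta> ^ (n div (\<Prod>j=1..i. p j))}) \<and>
     degree_sequence (cluster_tower bs) =
           n # map (\<lambda>i. n * totient (\<Prod>j=1..i. p j)) [2..<Suc k] \<and>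
     (\<forall>i\<in>{2..k}. root_count_rat (L i) a = (\<Prod>j=1..i. p j)) \<and>
     root_count_rat (L 1) a = 1"
proof -
  define P where "P i = (\<Prod>j=1..i. p j)" for i
  define b where "b j = a * \<zeta> ^ (n div p j)" for j
  have prime: "Factorial_Ring.prime (p i)" "odd (p i)" if "i \<in> {1..k}" for i
    using p_prime that by auto
  have p3: "p i > 2" if "i \<in> {1..k}" for i
    using prime_ge_2_nat[OF prime(1)[OF that]] prime(2)[OF that] by (cases "p i = 2") auto
  have cop: "coprime (p i) (p j)" if "i \<in> {1..k}" "j \<in> {1..k}" "i \<noteq> j" for i j
    using prime(1)[OF that(1)] prime(1)[OF that(2)] inj_onD[OF p_distinct, of i j] that
    by (intro primes_coprime) auto
  have P_dvd: "P i dvd n" if "i \<le> k" for i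
    unfolding P_def n using that by (intro prod_dvd_prod_subset) auto
  have p_dvd: "p i dvd n" if "i \<in> {1..k}" for i
    unfolding n using that by (intro dvd_prodI) auto
  have "odd n" unfolding n using prime(2) by (simp add: even_prod_iff)
  have sqf: "squarefree n" unfolding n
    using cop prime(1) by (intro squarefree_prod_coprime) (auto intro: squarefree_prime)
  have n_pos: "n > 0" using \<open>odd n\<close> by (auto intro: Nat.gr0I)
  have "complex_of_real (real_of_rat c) = of_rat c" by (cases c) (simp add: of_rat_rat)
  then have a_pow: "a ^ n = of_rat c"
    using c n_pos by (simp add: a flip: of_real_power)
  interpret real_radical_extension n c \<zeta> a
  proof
    show "a \<noteq> 0" using c n_pos by (simp add: a)
    show "a \<in> \<real>" by (simp add: a)
  qed (use \<open>odd n\<close> \<zeta> f_irreducible f a_pow in auto)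
  have \<zeta>_pow: "(\<zeta> ^ i) ^ n = 1" for i using z_power by (metis mult.commute power_mult power_one)
  have b_pow: "b j ^ n = of_rat c" for j by (simp add: b_def power_mult_distrib a_pow \<zeta>_pow)
  have L_b: "L i = adjoin_rat (b ` {1..i})" for i using L by (simp add: b_def)
  have L1: "L 1 = root_extension (b 1) 1"
    unfolding L_b adjoin_root_eq_root_extension[symmetric] by simp
  have L_eq: "L i = root_extension a (P i)" if "i \<in> {2..k}" for i
    unfolding L_b b_def P_def
  proof (rule adjoin_radicals_eq_root_extension)
    \<comment> \<open>Isolating \<open>a\<close> takes a quotient of two generators, here the first
      two, so this description of the fields starts at \<open>i = 2\<close>.\<close>
    show "(1::nat) \<in> {1..i}" "2 \<in> {1..i}" using that by auto
    show "(\<Prod>j = 1..i. p j) dvd n" using P_dvd[of i] that by (simp add: P_def)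
  qed (use that cop in auto)
  have split: "splitting_field_rat f = adjoin_rat {a, \<zeta>}"
    unfolding f by (rule splitting_field_rat_eq)
  have "P k = n" by (simp add: P_def n)
  then have Lk: "L k = splitting_field_rat f"
    using k L_eq[of k] n_pos by (simp add: split root_extension_def)

  have b_inj: "inj_on b {1..k}"
  proof (rule inj_onI)
    fix i j assume ij: "i \<in> {1..k}" "j \<in> {1..k}" "b i = b j"
    have "n div p i \<in> {0<..n}" if "i \<in> {1..k}" for i
    proof -
      have "p i \<le> n" using dvd_imp_le[OF p_dvd[OF that] n_pos] .
      then show ?thesis using p3[OF that] by (simp add: div_greater_zero_iff)
    qed
    moreover have "\<zeta> ^ (n div p i) = \<zeta> ^ (n div p j)" using ij(3) a_nonzero by (simp add: b_def)
    ultimately have "n div p i = n div p j"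
      using ij inj_onD[OF primitive_root_of_unity_inj_on[OF \<zeta>]] by blast
    \<comment> \<open>Dividing \<open>n\<close> by the exponent recovers the prime.\<close>
    then have "n div (n div p i) = n div (n div p j)" by simp
    moreover have "n div (n div p i) = p i" if "i \<in> {1..k}" for i
      using p_dvd[OF that] n_pos by (metis div_div_eq_right div_self dvd_refl mult_1 less_irrefl)
    ultimately have "p i = p j" using ij by simp
    then show "i = j" using ij inj_onD[OF p_distinct] by blast
  qed
  have bs_b: "bs = map b [1..<Suc k]" by (simp add: bs b_def)
  have set_bs: "set bs = b ` {1..k}" unfolding bs_b set_map set_upt atLeastLessThanSuc_atLeastAtMost ..
  have "distinct bs" using b_inj unfolding bs_b distinct_map set_upt atLeastLessThanSuc_atLeastAtMost by simp

  have minimal: "minimal_generating_set f (set bs)"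
    unfolding minimal_generating_set_def
  proof (intro conjI allI impI)
    show "set bs \<subseteq> complex_roots f" unfolding set_bs f complex_roots_eq using b_pow by auto
    show "adjoin_rat (set bs) = splitting_field_rat f" using Lk by (simp add: set_bs L_b)
    fix A assume A: "A \<subset> set bs"
    then obtain j where j: "j \<in> {1..k}" "b j \<notin> A" unfolding set_bs by blast
    \<comment> \<open>Without \<open>b j\<close>, all remaining generators lie in the field
      generated by \<open>a\<close> and the roots of unity of order \<open>M = n / p j\<close>,
      which does not contain \<zeta>.\<close>
    obtain M where M: "n = p j * M" using p_dvd[OF j(1)] by blast
    have M_dvd: "M dvd n" unfolding M by simp
    have "M > 0" using M n_pos by (auto intro: Nat.gr0I)
    then have nM: "n div M = p j" unfolding M by simp
    note E = root_extension_subfield[of a M]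
    have "b i \<in> root_extension a M" if "i \<in> {1..k}" "i \<noteq> j" for i
    proof -
      have "p j * p i dvd n" using p_dvd j that cop by (intro divides_mult) auto
      then have "p i dvd M" using M p3[OF j(1)] by auto
      then obtain u where u: "M = p i * u" by blast
      have "n div p i = p j * u" unfolding M u using p3[OF that(1)] by simp
      then have "n div M dvd n div p i" unfolding nM by simp
      then have "\<zeta> ^ (n div p i) \<in> root_extension a M"
        using power_in_root_extension_iff[OF a_pow M_dvd sqf] by simp
      moreover have "a \<in> root_extension a M" unfolding root_extension_def by (rule adjoin_rat_incl) simp
      ultimately show ?thesis unfolding b_def by (intro subfield_mult[OF E])
    qed
    moreover have "A \<subseteq> b ` ({1..k} - {j})" using A j(2) unfolding set_bs by blast
    ultimately have "A \<subseteq> root_extension a M" by blast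
    then have sub: "adjoin_rat A \<subseteq> root_extension a M" by (rule adjoin_rat_subsetI[OF E])
    show "adjoin_rat A \<noteq> splitting_field_rat f"
    proof
      assume "adjoin_rat A = splitting_field_rat f"
      moreover have "\<zeta> \<in> adjoin_rat {a, \<zeta>}" by (rule adjoin_rat_incl) simp
      ultimately have "\<zeta> ^ 1 \<in> root_extension a M" using sub split by auto
      then have "n div M dvd 1" using power_in_root_extension_iff[OF a_pow M_dvd sqf] by blast
      then show False using p3[OF j(1)] by (simp add: nM)
    qed
  qed

  define T where "T i = (if i = 0 then \<rat> else L i)" for i
  \<comment> \<open>Index 1 is special: \<open>L 1\<close> is generated by a single root and has
    degree \<open>n\<close>, not \<open>n\<close> times the totient of \<open>p 1\<close>.\<close>
  define D where "D i = (if i = 0 then 1 else if i = 1 then n else n * totient (P i))" for i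
  have deg: "degree_rat (T i) = D i" if "i \<le> k" for i
  proof -
    consider "i = 0" | "i = 1" | "i \<ge> 2" by linarith
    then show ?thesis
    proof cases
      case 2
      then show ?thesis using degree_root_extension[OF b_pow[of 1], of 1] by (simp add: T_def D_def L1[simplified])
    next
      case 3
      then show ?thesis using degree_root_extension[OF a_pow P_dvd[OF that]] that by (simp add: T_def D_def L_eq)
    qed (simp add: T_def D_def degree_rat_Rats)
  qed
  have tot_step: "totient (P (Suc i)) = totient (P i) * (p (Suc i) - 1)" if "i < k" for i
  proof -
    have "coprime (P i) (p (Suc i))" unfolding P_def
      using cop that by (intro prod_coprime_left) auto
    then show ?thesis
      using prime(1)[of "Suc i"] that by (simp add: P_def totient_mult_coprime totient_prime)
  qed
  have P_pos: "P i > 0" if "i \<le> k" for i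
    using P_dvd[OF that] n_pos by (auto intro: Nat.gr0I)
  have tot_less: "totient (P i) < totient (P (Suc i))" if "i < k" for i
  proof -
    \<comment> \<open>The new factor \<open>p (Suc i) - 1\<close> is at least 2 because the primes
      are odd.\<close>
    have "totient (P i) * 1 < totient (P i) * (p (Suc i) - 1)"
      using p3[of "Suc i"] P_pos[of i] that by (intro mult_strict_left_mono) auto
    then show ?thesis using tot_step[OF that] by simp
  qed
  have D_step: "D i < D (Suc i)" if "i < k" for i
  proof -
    consider "i = 0" | "i = 1" | "i \<ge> 2" by linarith
    then show ?thesis
    proof cases
      case 1
      have "n > 1" using dvd_imp_le[OF p_dvd[of 1] n_pos] p3[of 1] k by simp
      then show ?thesis by (simp add: D_def 1)
    next
      case 2
      have "totient (P 1) \<ge> 1" using P_pos[of 1] k by (simp add: Suc_le_eq)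
      then have "1 < totient (P (Suc 1))" using tot_less[of 1] k by simp
      then show ?thesis using n_pos by (simp add: D_def 2)
    next
      case 3
      then show ?thesis using tot_less[OF that] n_pos by (simp add: D_def)
    qed
  qed
  have D_less: "D i < D j" if "i < j" "j \<le> k" for i j
    using that
  proof (induction j)
    case (Suc j)
    then show ?case using D_step[of j] by (cases "i = j") auto
  qed simp
  \<comment> \<open>Strictly increasing degrees separate the fields. This gives strict inclusions, a
    tower without repetitions, and that only its first field is the rationals.\<close>
  have T_inj: "inj_on T {0..k}"
  proof (rule linorder_inj_onI)
    fix i j assume "i < j" "i \<in> {0..k}" "j \<in> {0..k}"
    then show "T i \<noteq> T j" using D_less[of i j] deg[of i] deg[of j] by auto
  qed auto

  have tower_T: "cluster_tower bs = map T [0..<Suc k]"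
  proof -
    have len: "length bs = k" by (simp add: bs_b)
    have "adjoin_rat (set (take i bs)) = T i" if "i \<le> k" for i
    proof (cases "i = 0")
      case True
      then show ?thesis by (simp add: T_def adjoin_rat_empty)
    next
      case False
      have "take i bs = map b [1..<Suc i]" unfolding bs_b take_map using that by (subst take_upt) auto
      then have "set (take i bs) = b ` {1..i}" by (simp only: set_map set_upt atLeastLessThanSuc_atLeastAtMost)
      then show ?thesis using False by (simp add: T_def L_b)
    qed
    then show ?thesis unfolding cluster_tower_def len by (intro map_cong) auto
  qed
  also have "\<dots> = T 0 # map T [1..<Suc k]" by (simp add: upt_conv_Cons del: upt_Suc)
  also have "\<dots> = \<rat> # map L [1..<Suc k]" by (simp add: T_def del: upt_Suc)
  finally have tower: "cluster_tower bs = \<rat> # map L [1..<Suc k]" .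

  have length: "tower_length (cluster_tower bs) = k"
  proof -
    have "T i \<subset> T (Suc i)" if "i < k" for i
    proof -
      have "T i \<subseteq> T (Suc i)"
      proof (cases "i = 0")
        case True
        then show ?thesis using Rats_subset_subfield[OF adjoin_rat_subfield] by (simp add: T_def L_b)
      next
        case False
        have "adjoin_rat (b ` {1..i}) \<subseteq> adjoin_rat (b ` {1..Suc i})"
          by (intro adjoin_rat_mono image_mono) auto
        with False show ?thesis unfolding T_def L_b by simp
      qed
      moreover have "T i \<noteq> T (Suc i)" using inj_onD[OF T_inj, of i "Suc i"] that by auto
      ultimately show ?thesis by blast
    qed
    moreover have "map T [0..<Suc k] ! i = T i" if "i \<le> k" for i
      using that by (simp del: upt_Suc)
    ultimately have "{i. Suc i < length (cluster_tower bs) \<and> cluster_tower bs ! i \<subset> cluster_tower bs ! Suc i} = {..<k}"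
      unfolding tower_T by (simp add: lessThan_def del: upt_Suc cong: conj_cong)
    then show ?thesis by (simp add: tower_length_def)
  qed

  have degrees: "degree_sequence (cluster_tower bs) = n # map (\<lambda>i. n * totient (P i)) [2..<Suc k]"
  proof -
    \<comment> \<open>Without repetitions \<open>remdups\<close> is the identity, and the filter
      removes just the first entry.\<close>
    have "distinct (cluster_tower bs)"
      using T_inj unfolding tower_T distinct_map set_upt atLeastLessThanSuc_atLeastAtMost by simp
    then have "degree_sequence (cluster_tower bs) = map degree_rat (filter (\<lambda>F. F \<noteq> \<rat>) (map T [0..<Suc k]))"
      by (simp add: degree_sequence_def tower_T distinct_remdups_id del: upt_Suc)
    also have "map T [0..<Suc k] = \<rat> # map T [1..<Suc k]"
      by (simp add: upt_conv_Cons T_def del: upt_Suc)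
    also have "filter (\<lambda>F. F \<noteq> \<rat>) (\<rat> # map T [1..<Suc k]) = map T [1..<Suc k]"
    proof -
      have "T i \<noteq> \<rat>" if "i \<in> {1..k}" for i
        using inj_onD[OF T_inj, of i 0] that by (auto simp: T_def)
      then show ?thesis by (auto simp del: upt_Suc intro!: filter_True)
    qed
    also have "map degree_rat (map T [1..<Suc k]) = map D [1..<Suc k]"
      using deg by (simp del: upt_Suc)
    also have "\<dots> = D 1 # map D [2..<Suc k]"
      using k by (simp add: upt_conv_Cons numeral_2_eq_2 del: upt_Suc)
    also have "\<dots> = n # map (\<lambda>i. n * totient (P i)) [2..<Suc k]"
      by (simp add: D_def del: upt_Suc)
    finally show ?thesis .
  qed

  have count: "root_count_rat (root_extension b' M) a = M" if "b' ^ n = of_rat c" "M dvd n" for b' M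
    unfolding root_count_rat_def min_poly_rat_eq complex_roots_eq
    by (rule card_roots_in_root_extension[OF that sqf])
  have "\<forall>i\<in>{2..k}. root_count_rat (L i) a = P i"
    using count[OF a_pow P_dvd] L_eq by simp
  moreover have "root_count_rat (L 1) a = 1" unfolding L1 by (rule count[OF b_pow]) simp
  moreover have "\<forall>i\<in>{2..k}. L i = adjoin_rat {a, \<zeta> ^ (n div P i)}"
    using L_eq by (simp add: root_extension_def)
  ultimately show ?thesis
    using split \<open>distinct bs\<close> minimal tower Lk length degrees unfolding P_def by blast
qed

end
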